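(* Let $A$ be a normal subgroup of a finite group $G$. The following statements are equivalent: (i) $\mathcal{Z}(\mathcal{U}(\mathbb{Z}[G]))\cap(1+\Delta(G)\Delta(A))$ is trivial, i.e. consists only of trivial units (it is contained in $\pm\mathcal{Z}(G)$); (ii) $\rho(G)=\rho(G/A)$.
   Context: For a group $G$, $\mathcal{U}(\mathbb{Z}[G])$ is the group of units of the integral group ring $\mathbb{Z}[G]$ and $\mathcal{Z}(\cdot)$ denotes the center of a group. A central unit of $\mathbb{Z}[G]$ is trivial if it lies in $\pm\mathcal{Z}(G)$. $\Delta(G)$ denotes the augmentation ideal of $\mathbb{Z}[G]$, and $\Delta(A)\subseteq\mathbb{Z}[A]\subseteq\mathbb{Z}[G]$ that of $\mathbb{Z}[A]$; $\Delta(G)\Delta(A)$ is the additive subgroup of $\mathbb{Z}[G]$ generated by all products $xy$ with $x\in\Delta(G)$, $y\in\Delta(A)$. For a finite group $G$, $\rho(G)$ denotes the (torsion-free) rank of the finitely generated abelian group $\mathcal{Z}(\mathcal{U}(\mathbb{Z}[G]))$. *)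

theory Defs
  imports "HOL-Algebra.Algebra" "HOL-Library.Poly_Mapping" "HOL-Library.Extended_Nat"
begin

text \<open>
  An element of \<open>\<int>[G]\<close> is a finitely supported map to the integers with support in
  \<open>carrier G\<close>; \<open>frag_of g\<close> is the basis element \<open>g\<close>. The product is the bilinear extension of the
  product of \<open>G\<close>. For a subgroup \<open>A\<close> of \<open>G\<close>, \<open>group_ring (G\<lparr>carrier := A\<rparr>)\<close> is literally a
  subset of \<open>group_ring G\<close>.
\<close>

definition group_ring :: "('a, 'm) monoid_scheme \<Rightarrow> ('a \<Rightarrow>\<^sub>0 int) ring" where
  "group_ring G =
    \<lparr>carrier = {f. Poly_Mapping.keys f \<subseteq> carrier G},
     monoid.mult = (\<lambda>f g. frag_extend (\<lambda>x. frag_extend (\<lambda>y. frag_of (x \<otimes>\<^bsub>G\<^esub> y)) g) f),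
     one = frag_of \<one>\<^bsub>G\<^esub>,
     ring.zero = 0,
     ring.add = (+)\<rparr>"

definition augmentation :: "('a \<Rightarrow>\<^sub>0 int) \<Rightarrow> int" where
  "augmentation f = (\<Sum>x\<in>Poly_Mapping.keys f. Poly_Mapping.lookup f x)"

definition augmentation_ideal :: "('a, 'm) monoid_scheme \<Rightarrow> ('a \<Rightarrow>\<^sub>0 int) set" where
  "augmentation_ideal G = {f \<in> carrier (group_ring G). augmentation f = 0}"

definition additive_product :: "('r, 'm) ring_scheme \<Rightarrow> 'r set \<Rightarrow> 'r set \<Rightarrow> 'r set" where
  "additive_product R I J = generate (add_monoid R) {x \<otimes>\<^bsub>R\<^esub> y | x y. x \<in> I \<and> y \<in> J}"

definition center :: "('a, 'm) monoid_scheme \<Rightarrow> 'a set" where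
  "center G = {z \<in> carrier G. \<forall>x\<in>carrier G. z \<otimes>\<^bsub>G\<^esub> x = x \<otimes>\<^bsub>G\<^esub> z}"

definition central_units :: "('a, 'm) monoid_scheme \<Rightarrow> ('a \<Rightarrow>\<^sub>0 int) set" where
  "central_units G = center (units_of (group_ring G))"

definition trivial_central_units :: "('a, 'm) monoid_scheme \<Rightarrow> ('a \<Rightarrow>\<^sub>0 int) set" where
  "trivial_central_units G = frag_of ` center G \<union> (\<lambda>z. - frag_of z) ` center G"

text \<open>
  \<open>\<int>\<close>-linear independence in an abelian group written multiplicatively; the torsion-free rank is
  the largest size of a finite independent subset, with value \<open>\<infinity>\<close> if there is no bound.
\<close>

definition int_independent :: "('a, 'm) monoid_scheme \<Rightarrow> 'a set \<Rightarrow> bool" where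
  "int_independent H S \<longleftrightarrow> S \<subseteq> carrier H \<and> finite S \<and>
    (\<forall>c :: 'a \<Rightarrow> int. finprod H (\<lambda>x. x [^]\<^bsub>H\<^esub> c x) S = \<one>\<^bsub>H\<^esub> \<longrightarrow> (\<forall>x\<in>S. c x = 0))"

definition torsion_free_rank :: "('a, 'm) monoid_scheme \<Rightarrow> enat" where
  "torsion_free_rank H = (SUP S\<in>{S. int_independent H S}. enat (card S))"

definition central_unit_rank :: "('a, 'm) monoid_scheme \<Rightarrow> enat" where
  "central_unit_rank G =
    torsion_free_rank ((units_of (group_ring G))\<lparr>carrier := central_units G\<rparr>)"

end

theory Submission
  imports Defs Complex_Main "HOL-Library.Function_Algebras"
    "HOL-Computational_Algebra.Fundamental_Theorem_Algebra"
begin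

text \<open>
  The projection \<open>\<pi> : \<int>[G] \<rightarrow> \<int>[G/A]\<close> maps central units to central units. Every central unit \<open>v\<close>
  of \<open>\<int>[G/A]\<close> has a power \<open>v\<^sup>k = 1 + m x\<close> with \<open>m = \<bar>A\<bar>\<close>, and this power lifts to
  \<open>1 + L x\<close>, where \<open>L\<close> sends a coset to the sum of its elements. A central unit in the kernel of
  \<open>\<pi>\<close> has a power in \<open>1 + \<Delta>(G)\<Delta>(A)\<close>, because \<open>m y \<in> \<Delta>(G)\<Delta>(A)\<close> whenever \<open>\<pi> y = 0\<close>. So, once the
  ranks are known to be finite, they agree iff \<open>\<Z>(\<U>(\<int>[G])) \<inter> (1 + \<Delta>(G)\<Delta>(A))\<close> is a
  torsion group, and by the theorem of Berman and Higman the torsion central units are the trivial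
  ones. Finiteness of the rank is the easy half of Dirichlet's unit theorem: the element \<open>1\<close> is a sum
  of joint eigenvectors of the centre acting on \<open>\<complex>[G]\<close>, and the logarithms of the absolute values
  of the eigenvalues embed the central units, up to a finite kernel, as a discrete group.
\<close>

section \<open>The group ring and its central units\<close>

text \<open>The same congruence modulo m = |A| is used on both sides: in Z[G/A] it makes a central
  unit liftable, in Z[G] it pushes a kernel element into the ideal. Each use replaces a unit by a
  power of it, which is harmless because the torsion-free rank sees neither torsion nor the passage
  to powers. The obstacle is the implication from (ii) to (i). A non-torsion central unit in the
  kernel enlarges every independent set lifted from the quotient by one element, but this
  contradicts equality of ranks only if the rank of G/A is finite; two infinite values would agree.
  Any finite bound serves for this purpose, however far from the true rank. It is therefore enough
  to diagonalise simultaneously the sums of conjugates of group elements, which are multiples of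
  class sums: they commute with each other and with their adjoints, so the spectral theorem for
  commuting normal operators applies. The eigenvectors occurring in one decomposition of the
  identity may be repeated or dependent; their number is still a bound.\<close>

lemma frag_cmul_minus: "frag_cmul k (- x) = - frag_cmul k x"
  by (simp add: poly_mapping_eqI)

lemma frag_cmul_diff: "frag_cmul k (x - y) = frag_cmul k x - frag_cmul k y"
  by (simp add: poly_mapping_eqI lookup_minus right_diff_distrib)

lemma frag_cmul_cancel:
  assumes "frag_cmul k x = frag_cmul k y" "k \<noteq> 0"
  shows "x = y"
proof -
  have "frag_cmul k (x - y) = 0"
    using assms(1) by (simp add: frag_cmul_diff)
  then show ?thesis
    using assms(2) by simp
qed

lemma frag_extend_add_fun: "frag_extend (\<lambda>x. f x + g x) a = frag_extend f a + frag_extend g a"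
  by (simp add: frag_extend_def frag_cmul_distrib2 sum.distrib)

lemma frag_extend_cmul_fun: "frag_extend (\<lambda>x. frag_cmul k (f x)) a = frag_cmul k (frag_extend f a)"
  by (simp add: frag_extend_def frag_cmul_sum mult.commute)

lemma lookup_frag_sum: "Poly_Mapping.lookup (sum f I) x = (\<Sum>i\<in>I. Poly_Mapping.lookup (f i) x)"
  by (induction I rule: infinite_finite_induct) (auto simp: lookup_add)

lemma zero_group_ring [simp]: "\<zero>\<^bsub>group_ring G\<^esub> = 0"
  and add_group_ring [simp]: "f \<oplus>\<^bsub>group_ring G\<^esub> g = f + g"
  and one_group_ring: "\<one>\<^bsub>group_ring G\<^esub> = frag_of \<one>\<^bsub>G\<^esub>"
  and carrier_group_ring: "f \<in> carrier (group_ring G) \<longleftrightarrow> Poly_Mapping.keys f \<subseteq> carrier G"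
  by (simp_all add: group_ring_def)

lemma mult_group_ring: "f \<otimes>\<^bsub>group_ring G\<^esub> g
    = frag_extend (\<lambda>x. frag_extend (\<lambda>y. frag_of (x \<otimes>\<^bsub>G\<^esub> y)) g) f"
  by (simp add: group_ring_def)

lemma frag_of_mult [simp]: "frag_of x \<otimes>\<^bsub>group_ring G\<^esub> frag_of y = frag_of (x \<otimes>\<^bsub>G\<^esub> y)"
  by (simp add: mult_group_ring)

lemma group_ring_distrib:
  "(f + g) \<otimes>\<^bsub>group_ring G\<^esub> h = f \<otimes>\<^bsub>group_ring G\<^esub> h + g \<otimes>\<^bsub>group_ring G\<^esub> h"
  "h \<otimes>\<^bsub>group_ring G\<^esub> (f + g) = h \<otimes>\<^bsub>group_ring G\<^esub> f + h \<otimes>\<^bsub>group_ring G\<^esub> g"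
  by (simp_all add: mult_group_ring frag_extend_add frag_extend_add_fun)

lemma group_ring_mult_zero [simp]:
  "0 \<otimes>\<^bsub>group_ring G\<^esub> h = 0" "h \<otimes>\<^bsub>group_ring G\<^esub> 0 = 0"
  by (simp_all add: mult_group_ring frag_extend_def)

lemma group_ring_cmul:
  "frag_cmul k f \<otimes>\<^bsub>group_ring G\<^esub> g = frag_cmul k (f \<otimes>\<^bsub>group_ring G\<^esub> g)"
  "f \<otimes>\<^bsub>group_ring G\<^esub> frag_cmul k g = frag_cmul k (f \<otimes>\<^bsub>group_ring G\<^esub> g)"
  by (simp_all add: mult_group_ring frag_extend_cmul frag_extend_cmul_fun)

lemma group_ring_minus:
  "(- f) \<otimes>\<^bsub>group_ring G\<^esub> g = - (f \<otimes>\<^bsub>group_ring G\<^esub> g)"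
  "f \<otimes>\<^bsub>group_ring G\<^esub> (- g) = - (f \<otimes>\<^bsub>group_ring G\<^esub> g)"
  using group_ring_cmul(1)[of G "-1" f g] group_ring_cmul(2)[of G f "-1" g] by simp_all

lemma group_ring_diff:
  "(f - g) \<otimes>\<^bsub>group_ring G\<^esub> h = f \<otimes>\<^bsub>group_ring G\<^esub> h - g \<otimes>\<^bsub>group_ring G\<^esub> h"
  "h \<otimes>\<^bsub>group_ring G\<^esub> (f - g) = h \<otimes>\<^bsub>group_ring G\<^esub> f - h \<otimes>\<^bsub>group_ring G\<^esub> g"
  using group_ring_distrib(1)[of G f "- g" h] group_ring_distrib(2)[of G h f "- g"]
  by (simp_all add: group_ring_minus)

lemma group_ring_sum:
  "sum f I \<otimes>\<^bsub>group_ring G\<^esub> g = (\<Sum>i\<in>I. f i \<otimes>\<^bsub>group_ring G\<^esub> g)"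
  "g \<otimes>\<^bsub>group_ring G\<^esub> sum f I = (\<Sum>i\<in>I. g \<otimes>\<^bsub>group_ring G\<^esub> f i)"
  by (induction I rule: infinite_finite_induct) (auto simp: group_ring_distrib)

lemma frag_of_in_group_ring [simp]: "frag_of x \<in> carrier (group_ring G) \<longleftrightarrow> x \<in> carrier G"
  by (simp add: carrier_group_ring)

lemma group_ring_closed [simp]:
  "0 \<in> carrier (group_ring G)"
  "f \<in> carrier (group_ring G) \<Longrightarrow> g \<in> carrier (group_ring G) \<Longrightarrow> f + g \<in> carrier (group_ring G)"
  "f \<in> carrier (group_ring G) \<Longrightarrow> g \<in> carrier (group_ring G) \<Longrightarrow> f - g \<in> carrier (group_ring G)"
  "f \<in> carrier (group_ring G) \<Longrightarrow> frag_cmul k f \<in> carrier (group_ring G)"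
  "f \<in> carrier (group_ring G) \<Longrightarrow> - f \<in> carrier (group_ring G)"
  using Poly_Mapping.keys_add[of f g] keys_diff[of f g] keys_cmul[of k f]
  by (auto simp: carrier_group_ring)

lemma group_ring_sum_closed:
  "(\<And>i. i \<in> I \<Longrightarrow> f i \<in> carrier (group_ring G)) \<Longrightarrow> sum f I \<in> carrier (group_ring G)"
  by (induction I rule: infinite_finite_induct) auto

text \<open>Group elements generate Z[G] under subtraction, so an identity that is additive in each
  argument needs checking on group elements only.\<close>

lemma group_ring_induct [consumes 1, case_names zero one diff]:
  assumes "f \<in> carrier (group_ring G)" "P 0"
    and "\<And>x. x \<in> carrier G \<Longrightarrow> P (frag_of x)"
    and "\<And>f g. P f \<Longrightarrow> P g \<Longrightarrow> P (f - g)"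
  shows "P f"
  using assms by (intro frag_induction[of f "carrier G" P]) (auto simp: carrier_group_ring)

lemma frag_extend_in_group_ring:
  assumes "f \<in> carrier (group_ring G)" "\<And>x. x \<in> carrier G \<Longrightarrow> h x \<in> carrier (group_ring G')"
  shows "frag_extend h f \<in> carrier (group_ring G')"
  using assms(1) by (induction rule: group_ring_induct) (auto simp: frag_extend_diff assms(2))

context group
begin

lemma group_ring_mult_closed [simp]:
  assumes f: "f \<in> carrier (group_ring G)" and g: "g \<in> carrier (group_ring G)"
  shows "f \<otimes>\<^bsub>group_ring G\<^esub> g \<in> carrier (group_ring G)"
  using g
proof (induction rule: group_ring_induct)
  case (one y)
  show ?case
    using f by (induction rule: group_ring_induct) (use one in \<open>auto simp: group_ring_diff\<close>)
qed (auto simp: group_ring_diff)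

lemma group_ring_assoc:
  assumes f: "f \<in> carrier (group_ring G)" and g: "g \<in> carrier (group_ring G)"
    and h: "h \<in> carrier (group_ring G)"
  shows "(f \<otimes>\<^bsub>group_ring G\<^esub> g) \<otimes>\<^bsub>group_ring G\<^esub> h
    = f \<otimes>\<^bsub>group_ring G\<^esub> (g \<otimes>\<^bsub>group_ring G\<^esub> h)"
  using h
proof (induction rule: group_ring_induct)
  case (one z)
  show ?case
    using g
  proof (induction rule: group_ring_induct)
    case (one y)
    show ?case
      using f
      by (induction rule: group_ring_induct)
        (use \<open>y \<in> carrier G\<close> \<open>z \<in> carrier G\<close> in \<open>auto simp: group_ring_diff m_assoc\<close>)
  qed (auto simp: group_ring_diff)
qed (auto simp: group_ring_diff)

lemma group_ring_one_mult [simp]: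
  assumes "f \<in> carrier (group_ring G)"
  shows "frag_of \<one> \<otimes>\<^bsub>group_ring G\<^esub> f = f" "f \<otimes>\<^bsub>group_ring G\<^esub> frag_of \<one> = f"
  using assms by (induction rule: group_ring_induct) (auto simp: group_ring_diff)

lemma ring_group_ring: "ring (group_ring G)"
proof (rule ringI)
  show "abelian_group (group_ring G)"
    by (rule abelian_groupI) (auto simp: add.assoc add.commute intro!: bexI[of _ "- x" for x])
  show "Group.monoid (group_ring G)"
    by (rule monoidI) (auto simp: one_group_ring group_ring_assoc)
qed (auto simp: group_ring_distrib)

lemma group_ring_commute:
  assumes f: "f \<in> carrier (group_ring G)"
    and "\<And>x. x \<in> carrier G \<Longrightarrow> u \<otimes>\<^bsub>group_ring G\<^esub> frag_of x = frag_of x \<otimes>\<^bsub>group_ring G\<^esub> u"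
  shows "u \<otimes>\<^bsub>group_ring G\<^esub> f = f \<otimes>\<^bsub>group_ring G\<^esub> u"
  using f by (induction rule: group_ring_induct) (auto simp: group_ring_diff assms(2))

lemma frag_of_Unit: "x \<in> carrier G \<Longrightarrow> frag_of x \<in> Units (group_ring G)"
  by (auto simp: Units_def one_group_ring intro!: bexI[of _ "frag_of (inv x)"])

text \<open>The definition tests commutation with units only. Group elements are units and generate
  Z[G] additively, so a central unit commutes with the whole ring.\<close>

lemma central_units_iff:
  "u \<in> central_units G \<longleftrightarrow> u \<in> Units (group_ring G) \<and>
    (\<forall>f\<in>carrier (group_ring G). u \<otimes>\<^bsub>group_ring G\<^esub> f = f \<otimes>\<^bsub>group_ring G\<^esub> u)"
  (is "_ \<longleftrightarrow> ?R")
proof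
  assume u: "u \<in> central_units G"
  then have "u \<in> Units (group_ring G)"
    and "\<And>v. v \<in> Units (group_ring G) \<Longrightarrow> u \<otimes>\<^bsub>group_ring G\<^esub> v = v \<otimes>\<^bsub>group_ring G\<^esub> u"
    by (auto simp: central_units_def center_def units_of_carrier units_of_mult)
  then show ?R
    using frag_of_Unit group_ring_commute by blast
next
  assume ?R
  then show "u \<in> central_units G"
    by (auto simp: central_units_def center_def units_of_carrier units_of_mult Units_def)
qed

end

definition central_unit_group :: "('a, 'm) monoid_scheme \<Rightarrow> ('a \<Rightarrow>\<^sub>0 int) monoid" where
  "central_unit_group G = (units_of (group_ring G))\<lparr>carrier := central_units G\<rparr>"

lemma carrier_central_unit_group [simp]: "carrier (central_unit_group G) = central_units G"
  and mult_central_unit_group [simp]: "monoid.mult (central_unit_group G) = monoid.mult (group_ring G)"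
  and one_central_unit_group [simp]: "\<one>\<^bsub>central_unit_group G\<^esub> = frag_of \<one>\<^bsub>G\<^esub>"
  by (simp_all add: central_unit_group_def units_of_mult units_of_one one_group_ring)

context group
begin

lemma central_unitsD:
  assumes "u \<in> central_units G"
  shows "u \<in> carrier (group_ring G)"
    and "f \<in> carrier (group_ring G) \<Longrightarrow> u \<otimes>\<^bsub>group_ring G\<^esub> f = f \<otimes>\<^bsub>group_ring G\<^esub> u"
  using assms by (auto simp: central_units_iff Units_def)

text \<open>A right inverse suffices: commuting with group elements makes \<open>u\<close> commute
  with \<open>v\<close>, so \<open>v\<close> is an inverse on both sides.\<close>

lemma central_unitsI:
  assumes "u \<in> carrier (group_ring G)" "v \<in> carrier (group_ring G)"
    and "u \<otimes>\<^bsub>group_ring G\<^esub> v = frag_of \<one>"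
    and "\<And>x. x \<in> carrier G \<Longrightarrow> u \<otimes>\<^bsub>group_ring G\<^esub> frag_of x = frag_of x \<otimes>\<^bsub>group_ring G\<^esub> u"
  shows "u \<in> central_units G"
  unfolding central_units_iff Units_def one_group_ring
  using assms group_ring_commute[OF _ assms(4)] group_ring_commute[OF assms(2,4)]
  by (auto intro!: bexI[of _ v])

lemma comm_group_central_units: "comm_group (central_unit_group G)"
proof -
  interpret R: ring "group_ring G"
    by (rule ring_group_ring)
  have one: "frag_of \<one> \<in> central_units G"
    by (rule central_unitsI[of _ "frag_of \<one>"]) auto
  have mult: "u \<otimes>\<^bsub>group_ring G\<^esub> v \<in> central_units G"
    if "u \<in> central_units G" "v \<in> central_units G" for u v
    using that by (auto simp: central_units_iff) (metis R.m_assoc R.Units_closed)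
  have "\<exists>v\<in>central_units G. v \<otimes>\<^bsub>group_ring G\<^esub> u = frag_of \<one>"
    if u: "u \<in> central_units G" for u
  proof -
    have uU: "u \<in> Units (group_ring G)"
      using u by (simp add: central_units_iff)
    define v where "v = inv\<^bsub>group_ring G\<^esub> u"
    have v: "v \<in> carrier (group_ring G)" "v \<otimes>\<^bsub>group_ring G\<^esub> u = frag_of \<one>"
      "u \<otimes>\<^bsub>group_ring G\<^esub> v = frag_of \<one>"
      using uU by (auto simp: v_def one_group_ring[symmetric])
    have "v \<otimes>\<^bsub>group_ring G\<^esub> frag_of x = frag_of x \<otimes>\<^bsub>group_ring G\<^esub> v" (is "?l = ?r")
      if x: "x \<in> carrier G" for x
    proof -
      \<comment> \<open>The inverse of a central unit is central: insert \<open>u\<close> times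
        \<open>v\<close> on the right, move \<open>u\<close> across \<open>frag_of x\<close>, and
        cancel it against the leading \<open>v\<close>.\<close>
      have "?l = v \<otimes>\<^bsub>group_ring G\<^esub> (frag_of x \<otimes>\<^bsub>group_ring G\<^esub> (u \<otimes>\<^bsub>group_ring G\<^esub> v))"
        using x v by simp
      also have "\<dots> = v \<otimes>\<^bsub>group_ring G\<^esub> ((u \<otimes>\<^bsub>group_ring G\<^esub> frag_of x) \<otimes>\<^bsub>group_ring G\<^esub> v)"
        using x v(1) central_unitsD[OF u] by (simp add: R.m_assoc)
      also have "\<dots> = (v \<otimes>\<^bsub>group_ring G\<^esub> u) \<otimes>\<^bsub>group_ring G\<^esub> (frag_of x \<otimes>\<^bsub>group_ring G\<^esub> v)"
        using x v(1) central_unitsD(1)[OF u] by (simp add: R.m_assoc)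
      finally show ?thesis
        using x v by simp
    qed
    with v central_unitsD(1)[OF u] have "v \<in> central_units G"
      by (intro central_unitsI[of _ u]) auto
    with v show ?thesis
      by blast
  qed
  then show ?thesis
    using one mult
    by (intro comm_groupI)
      (auto simp: group_ring_assoc central_unitsD(1) intro: central_unitsD(2))
qed

end

section \<open>Projection to the quotient\<close>

context group
begin

interpretation C: comm_group "central_unit_group G"
  by (rule comm_group_central_units)

lemma central_unit_inv:
  assumes "u \<in> central_units G"
  shows "inv\<^bsub>central_unit_group G\<^esub> u \<in> central_units G"
    and "u \<otimes>\<^bsub>group_ring G\<^esub> inv\<^bsub>central_unit_group G\<^esub> u = frag_of \<one>"
    and "inv\<^bsub>central_unit_group G\<^esub> u \<otimes>\<^bsub>group_ring G\<^esub> u = frag_of \<one>"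
  using C.inv_closed[of u] C.r_inv[of u] C.l_inv[of u] assms by simp_all

text \<open>Pigeonhole: coefficients modulo \<open>m\<close> on a finite group take finitely many
  values, so the powers with exponents \<open>i < j\<close> agree modulo \<open>m\<close> for some
  \<open>i\<close>, \<open>j\<close>. Multiplying their difference by the inverse of the
  \<open>i\<close>-th power gives the congruence with \<open>k = j - i\<close>.\<close>

lemma central_unit_pow_cong:
  assumes fin: "finite (carrier G)" and u: "u \<in> central_units G" and "m > 0"
  obtains k :: nat and y where "k > 0" "y \<in> carrier (group_ring G)"
    "u [^]\<^bsub>central_unit_group G\<^esub> k = frag_of \<one> + frag_cmul (int m) y"
proof -
  let ?pow = "\<lambda>i::nat. u [^]\<^bsub>central_unit_group G\<^esub> i"
  define res where "res i = restrict (\<lambda>x. Poly_Mapping.lookup (?pow i) x mod int m) (carrier G)" for i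
  have pow_in: "?pow i \<in> central_units G" for i
    using C.nat_pow_closed[of u i] u by simp
  have "range res \<subseteq> (\<Pi>\<^sub>E x\<in>carrier G. {0..<int m})"
    using \<open>m > 0\<close> by (auto simp: res_def)
  then have "finite (range res)"
    by (rule finite_subset) (auto intro!: finite_PiE fin)
  then have "\<not> inj res"
    using finite_imageD by blast
  then obtain i j where ij: "i < j" "res i = res j"
    unfolding inj_def by (metis linorder_neqE_nat)
  define d where "d = ?pow j - ?pow i"
  have d: "d \<in> carrier (group_ring G)"
    unfolding d_def using central_unitsD(1) pow_in by simp
  have "int m dvd Poly_Mapping.lookup d x" for x
  proof (cases "x \<in> carrier G")
    case True
    then have "Poly_Mapping.lookup (?pow j) x mod int m = Poly_Mapping.lookup (?pow i) x mod int m"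
      using fun_cong[OF ij(2), of x] by (simp add: res_def)
    then show ?thesis
      by (simp add: d_def lookup_minus mod_eq_dvd_iff)
  next
    case False
    then have "x \<notin> Poly_Mapping.keys d"
      using d by (auto simp: carrier_group_ring)
    then show ?thesis
      by (simp add: in_keys_iff)
  qed
  then have "\<exists>z. d = frag_cmul (int m) z"
    using \<open>m > 0\<close>
    by (intro exI[of _ "Poly_Mapping.map (\<lambda>c. c div int m) d"] poly_mapping_eqI)
      (simp add: Poly_Mapping.map.rep_eq when_def)
  then obtain z where z: "d = frag_cmul (int m) z"
    by blast
  have zR: "z \<in> carrier (group_ring G)"
    using d \<open>m > 0\<close> unfolding z carrier_group_ring by auto
  define w where "w = inv\<^bsub>central_unit_group G\<^esub> (?pow i)"
  have w: "w \<in> central_units G" "?pow i \<otimes>\<^bsub>group_ring G\<^esub> w = frag_of \<one>"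
    unfolding w_def using central_unit_inv[OF pow_in] by auto
  have "?pow j = ?pow (j - i) \<otimes>\<^bsub>group_ring G\<^esub> ?pow i"
    using C.nat_pow_mult[of u "j - i" i] u ij(1) by simp
  then have "?pow j \<otimes>\<^bsub>group_ring G\<^esub> w = ?pow (j - i)"
    using pow_in w central_unitsD(1) by (simp add: group_ring_assoc)
  then have "?pow (j - i) = frag_of \<one> + d \<otimes>\<^bsub>group_ring G\<^esub> w"
    by (simp add: d_def group_ring_diff w)
  also have "d \<otimes>\<^bsub>group_ring G\<^esub> w = frag_cmul (int m) (z \<otimes>\<^bsub>group_ring G\<^esub> w)"
    by (simp add: z group_ring_cmul)
  finally show ?thesis
    using ij(1) zR w(1) central_unitsD(1) by (intro that[of "j - i" "z \<otimes>\<^bsub>group_ring G\<^esub> w"]) auto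
qed

end

text \<open>The defining sum runs over a support that varies with \<open>f\<close>. Mapping all of G
  to one point gives the same number through \<open>frag_extend\<close>, whose additivity is then
  inherited.\<close>

lemma augmentation_eq_frag_extend:
  "augmentation f = Poly_Mapping.lookup (frag_extend (\<lambda>x. frag_of ()) f) ()"
  by (simp add: augmentation_def frag_extend_def lookup_frag_sum)

lemma augmentation_frag_of [simp]: "augmentation (frag_of x) = 1"
  and augmentation_zero [simp]: "augmentation 0 = 0"
  and augmentation_diff: "augmentation (f - g) = augmentation f - augmentation g"
  and augmentation_minus: "augmentation (- f) = - augmentation f"
  by (simp_all add: augmentation_eq_frag_extend frag_extend_diff frag_extend_minus lookup_minus)

section \<open>Projection to cosets and coset sums\<close>

definition coset_proj where
  "coset_proj G A = frag_extend (\<lambda>x. frag_of (A #>\<^bsub>G\<^esub> x))"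

text \<open>Up to the identification of \<open>\<int>[G/A]\<close> with \<open>\<int>[G]e\<close>, where \<open>e\<close> is the averaging idempotent
  of \<open>A\<close>, this is multiplication by \<open>\<bar>A\<bar>\<close>.\<close>

definition coset_lift :: "('a set \<Rightarrow>\<^sub>0 int) \<Rightarrow> ('a \<Rightarrow>\<^sub>0 int)" where
  "coset_lift = frag_extend (\<lambda>C. \<Sum>c\<in>C. frag_of c)"

lemma coset_proj_simps [simp]:
  "coset_proj G A (frag_of x) = frag_of (A #>\<^bsub>G\<^esub> x)"
  "coset_proj G A 0 = 0"
  "coset_proj G A (f - g) = coset_proj G A f - coset_proj G A g"
  "coset_proj G A (f + g) = coset_proj G A f + coset_proj G A g"
  "coset_proj G A (- f) = - coset_proj G A f"
  "coset_proj G A (frag_cmul k f) = frag_cmul k (coset_proj G A f)"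
  by (simp_all add: coset_proj_def frag_extend_diff frag_extend_add frag_extend_minus frag_extend_cmul)

lemma coset_proj_sum: "coset_proj G A (sum f I) = (\<Sum>i\<in>I. coset_proj G A (f i))"
  by (induction I rule: infinite_finite_induct) auto

lemma coset_lift_simps [simp]:
  "coset_lift (frag_of C) = (\<Sum>c\<in>C. frag_of c)"
  "coset_lift 0 = 0"
  "coset_lift (f - g) = coset_lift f - coset_lift g"
  "coset_lift (f + g) = coset_lift f + coset_lift g"
  "coset_lift (frag_cmul k f) = frag_cmul k (coset_lift f)"
  by (simp_all add: coset_lift_def frag_extend_diff frag_extend_add frag_extend_cmul)

lemma augmentation_coset_proj: "augmentation (coset_proj G A f) = augmentation f"
  using subset_UNIV by (induction f rule: frag_induction) (auto simp: augmentation_diff)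

context normal
begin

lemma card_pos: "finite (carrier G) \<Longrightarrow> card H > 0"
  using finite_subset[OF subset] subgroup.one_closed[OF is_subgroup]
  by (metis card_gt_0_iff empty_iff)

lemma carrier_Mod: "carrier (G Mod H) = (\<lambda>x. H #> x) ` carrier G"
  by (auto simp: FactGroup_def RCOSETS_def)

lemma coset_proj_closed:
  assumes "f \<in> carrier (group_ring G)"
  shows "coset_proj G H f \<in> carrier (group_ring (G Mod H))"
  unfolding coset_proj_def
  using assms by (rule frag_extend_in_group_ring) (auto simp: carrier_Mod)

lemma coset_lift_closed:
  assumes "f \<in> carrier (group_ring (G Mod H))"
  shows "coset_lift f \<in> carrier (group_ring G)"
  unfolding coset_lift_def
proof (rule frag_extend_in_group_ring[OF assms])
  fix C assume "C \<in> carrier (G Mod H)"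
  then have "C \<subseteq> carrier G"
    using r_coset_subset_G[OF subset] by (auto simp: carrier_Mod)
  then show "(\<Sum>c\<in>C. frag_of c) \<in> carrier (group_ring G)"
    by (auto intro!: group_ring_sum_closed)
qed

lemma mult_Mod_cosets:
  "x \<in> carrier G \<Longrightarrow> y \<in> carrier G \<Longrightarrow> (H #> x) \<otimes>\<^bsub>G Mod H\<^esub> (H #> y) = H #> (x \<otimes> y)"
  by (simp add: FactGroup_def rcos_sum)

lemma coset_proj_mult:
  assumes f: "f \<in> carrier (group_ring G)" and g: "g \<in> carrier (group_ring G)"
  shows "coset_proj G H (f \<otimes>\<^bsub>group_ring G\<^esub> g)
    = coset_proj G H f \<otimes>\<^bsub>group_ring (G Mod H)\<^esub> coset_proj G H g"
  using g
proof (induction rule: group_ring_induct)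
  case (one y)
  show ?case
    using f by (induction rule: group_ring_induct)
      (use one in \<open>auto simp: group_ring_diff mult_Mod_cosets simp del: mult_FactGroup\<close>)
qed (auto simp: group_ring_diff)

lemma coset_proj_one [simp]: "coset_proj G H (frag_of \<one>) = frag_of \<one>\<^bsub>G Mod H\<^esub>"
  using coset_mult_one[OF subset] by simp

text \<open>For left translation normality is used to read a right coset as a left one; right
  translation permutes the right cosets directly.\<close>

lemma coset_translate:
  assumes x: "x \<in> carrier G" and g: "g \<in> carrier G"
  shows "(\<Sum>c\<in>H #> x. frag_of (g \<otimes> c)) = (\<Sum>c\<in>H #> (g \<otimes> x). frag_of c)"
    and "(\<Sum>c\<in>H #> x. frag_of (c \<otimes> g)) = (\<Sum>c\<in>H #> (x \<otimes> g). frag_of c)"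
proof -
  have sub: "H #> x \<subseteq> carrier G"
    using x by (rule r_coset_subset_G[OF subset])
  have "(\<lambda>c. g \<otimes> c) ` (H #> x) = g <# (x <# H)"
    using coset_eq x by (auto simp: l_coset_def)
  also have "\<dots> = H #> (g \<otimes> x)"
    using coset_eq x g lcos_m_assoc[OF subset g x] by simp
  finally have "sum frag_of (H #> (g \<otimes> x)) = sum frag_of ((\<lambda>c. g \<otimes> c) ` (H #> x))"
    by simp
  also have "\<dots> = (\<Sum>c\<in>H #> x. frag_of (g \<otimes> c))"
    using sub g by (subst sum.reindex) (auto intro!: inj_onI simp: subset_iff)
  finally show "(\<Sum>c\<in>H #> x. frag_of (g \<otimes> c)) = (\<Sum>c\<in>H #> (g \<otimes> x). frag_of c)" ..
  have "(\<lambda>c. c \<otimes> g) ` (H #> x) = (H #> x) #> g"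
    by (auto simp: r_coset_def)
  also have "\<dots> = H #> (x \<otimes> g)"
    by (rule coset_mult_assoc[OF subset x g])
  finally have "sum frag_of (H #> (x \<otimes> g)) = sum frag_of ((\<lambda>c. c \<otimes> g) ` (H #> x))"
    by simp
  also have "\<dots> = (\<Sum>c\<in>H #> x. frag_of (c \<otimes> g))"
    using sub g by (subst sum.reindex) (auto intro!: inj_onI simp: subset_iff)
  finally show "(\<Sum>c\<in>H #> x. frag_of (c \<otimes> g)) = (\<Sum>c\<in>H #> (x \<otimes> g). frag_of c)" ..
qed

text \<open>\<open>coset_lift\<close> is a map of Z[G]-bimodules when Z[G] acts on Z[G/A] through
  the projection. This yields both the product of two lifts and the centrality of a lift.\<close>

lemma coset_lift_mult:
  assumes f: "f \<in> carrier (group_ring G)" and x: "x \<in> carrier (group_ring (G Mod H))"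
  shows "f \<otimes>\<^bsub>group_ring G\<^esub> coset_lift x
      = coset_lift (coset_proj G H f \<otimes>\<^bsub>group_ring (G Mod H)\<^esub> x)" (is ?l)
    and "coset_lift x \<otimes>\<^bsub>group_ring G\<^esub> f
      = coset_lift (x \<otimes>\<^bsub>group_ring (G Mod H)\<^esub> coset_proj G H f)" (is ?r)
proof -
  have "?l \<and> ?r"
    using x
  proof (induction rule: group_ring_induct)
    case (one C)
    then obtain c where c: "c \<in> carrier G" "C = H #> c"
      by (auto simp: carrier_Mod)
    show ?case
      using f
    proof (induction rule: group_ring_induct)
      case (one y)
      then show ?case
        using c
        by (auto simp: group_ring_sum mult_Mod_cosets coset_translate simp del: mult_FactGroup)
    qed (auto simp: group_ring_diff)
  qed (auto simp: group_ring_diff)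
  then show ?l ?r
    by auto
qed

lemma coset_proj_lift:
  assumes "x \<in> carrier (group_ring (G Mod H))"
  shows "coset_proj G H (coset_lift x) = frag_cmul (int (card H)) x"
  using assms
proof (induction rule: group_ring_induct)
  case (one C)
  then obtain c where c: "c \<in> carrier G" "C = H #> c"
    by (auto simp: carrier_Mod)
  have "coset_proj G H (coset_lift (frag_of C)) = (\<Sum>y\<in>C. frag_of (H #> y))"
    by (simp add: coset_proj_sum)
  also have "\<dots> = (\<Sum>y\<in>C. frag_of C)"
    using c repr_independence[OF _ c(1) is_subgroup] by (auto intro!: sum.cong)
  also have "\<dots> = frag_cmul (int (card C)) (frag_of C)"
    by (rule poly_mapping_eqI) (simp add: lookup_frag_sum)
  also have "card C = card H"
    using card_rcosets_equal[OF _ subset, of C] one by (simp add: FactGroup_def)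
  finally show ?case .
qed (auto simp: frag_cmul_diff)

lemma group_Mod: "group (G Mod H)"
  by (rule factorgroup_is_group)

lemma coset_proj_central_units:
  assumes u: "u \<in> central_units G"
  shows "coset_proj G H u \<in> central_units (G Mod H)"
proof -
  interpret Q: group "G Mod H"
    by (rule group_Mod)
  note R = central_unitsD(1)[OF u] central_unit_inv[OF u]
    central_unitsD(1)[OF central_unit_inv(1)[OF u]]
  show ?thesis
  proof (rule Q.central_unitsI)
    show "coset_proj G H u \<otimes>\<^bsub>group_ring (G Mod H)\<^esub>
        coset_proj G H (inv\<^bsub>central_unit_group G\<^esub> u) = frag_of \<one>\<^bsub>G Mod H\<^esub>"
      using R coset_proj_one by (simp flip: coset_proj_mult)
  next
    fix C assume "C \<in> carrier (G Mod H)"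
    then obtain c where c: "c \<in> carrier G" "C = H #> c"
      by (auto simp: carrier_Mod)
    then have C: "frag_of C = coset_proj G H (frag_of c)"
      by simp
    show "coset_proj G H u \<otimes>\<^bsub>group_ring (G Mod H)\<^esub> frag_of C
        = frag_of C \<otimes>\<^bsub>group_ring (G Mod H)\<^esub> coset_proj G H u"
      unfolding C using c R(1) central_unitsD(2)[OF u, of "frag_of c"]
      by (simp flip: coset_proj_mult del: coset_proj_simps(1))
  qed (use R coset_proj_closed in auto)
qed

lemma coset_proj_group_hom:
  "group_hom (central_unit_group G) (central_unit_group (G Mod H)) (coset_proj G H)"
proof -
  interpret Q: group "G Mod H"
    by (rule group_Mod)
  show ?thesis
    using comm_group.axioms(2)[OF comm_group_central_units]
      comm_group.axioms(2)[OF Q.comm_group_central_units]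
    by (auto simp: group_hom_def group_hom_axioms_def hom_def coset_proj_central_units
        coset_proj_mult central_unitsD(1))
qed

text \<open>Writing L for \<open>coset_lift\<close>, the bimodule property gives
  \<open>L x L y = L (m x y)\<close>. The relation \<open>x + y + m x y = 0\<close>, which says that
  \<open>1 + m x\<close> and \<open>1 + m y\<close> are inverse to each other, therefore becomes
  under L the statement that \<open>1 + L x\<close> and \<open>1 + L y\<close> are.\<close>

lemma ex_pow_in_coset_proj_image:
  assumes fin: "finite (carrier G)" and v: "v \<in> central_units (G Mod H)"
  obtains k :: nat and u where "k > 0" "u \<in> central_units G"
    "coset_proj G H u = v [^]\<^bsub>central_unit_group (G Mod H)\<^esub> k"
proof -
  interpret Q: group "G Mod H"
    by (rule group_Mod)
  interpret QC: comm_group "central_unit_group (G Mod H)"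
    by (rule Q.comm_group_central_units)
  define m where "m = card H"
  have "m > 0"
    unfolding m_def using fin by (rule card_pos)
  have "finite (carrier (G Mod H))"
    using fin by (simp add: carrier_Mod)
  then obtain k :: nat and x where k: "k > 0" and x: "x \<in> carrier (group_ring (G Mod H))"
    and vk: "v [^]\<^bsub>central_unit_group (G Mod H)\<^esub> k = frag_of \<one>\<^bsub>G Mod H\<^esub> + frag_cmul (int m) x"
    by (rule Q.central_unit_pow_cong[OF _ v \<open>m > 0\<close>])
  define vk where "vk = v [^]\<^bsub>central_unit_group (G Mod H)\<^esub> k"
  have vkC: "vk \<in> central_units (G Mod H)"
    using QC.nat_pow_closed[of v k] v by (simp add: vk_def)
  define w where "w = inv\<^bsub>central_unit_group (G Mod H)\<^esub> vk"
  have w: "w \<in> carrier (group_ring (G Mod H))"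
    "vk \<otimes>\<^bsub>group_ring (G Mod H)\<^esub> w = frag_of \<one>\<^bsub>G Mod H\<^esub>"
    unfolding w_def using Q.central_unit_inv[OF vkC] Q.central_unitsD(1) by auto
  \<comment> \<open>From \<open>(1 + m x) w = 1\<close> follows \<open>w = 1 - m x w\<close>, so the
    inverse has the same shape with this \<open>y\<close>.\<close>
  define y where "y = - (x \<otimes>\<^bsub>group_ring (G Mod H)\<^esub> w)"
  have y: "y \<in> carrier (group_ring (G Mod H))"
    using x w by (simp add: y_def)
  have w_eq: "w = frag_of \<one>\<^bsub>G Mod H\<^esub> + frag_cmul (int m) y"
    using w unfolding vk_def vk
    by (simp add: group_ring_distrib group_ring_cmul y_def frag_cmul_minus eq_diff_eq
        del: one_FactGroup minus_frag_cmul)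
  have "frag_cmul (int m) (x + y + frag_cmul (int m) (x \<otimes>\<^bsub>group_ring (G Mod H)\<^esub> y)) = 0"
    using w(2) unfolding vk_def vk w_eq
    by (simp add: group_ring_distrib group_ring_cmul frag_cmul_distrib2 x y
        del: one_FactGroup mult_FactGroup) (simp add: algebra_simps)
  then have xy: "x + y + frag_cmul (int m) (x \<otimes>\<^bsub>group_ring (G Mod H)\<^esub> y) = 0"
    using \<open>m > 0\<close> by simp
  define u where "u = frag_of \<one> + coset_lift x"
  have "u \<in> central_units G"
  proof (rule central_unitsI)
    show "u \<in> carrier (group_ring G)" "frag_of \<one> + coset_lift y \<in> carrier (group_ring G)"
      by (simp_all add: u_def x y coset_lift_closed)
    have "u \<otimes>\<^bsub>group_ring G\<^esub> (frag_of \<one> + coset_lift y)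
        = frag_of \<one> + (coset_lift x + coset_lift y + coset_lift x \<otimes>\<^bsub>group_ring G\<^esub> coset_lift y)"
      by (simp add: u_def group_ring_distrib coset_lift_closed x y)
    also have "coset_lift x \<otimes>\<^bsub>group_ring G\<^esub> coset_lift y
        = coset_lift (frag_cmul (int m) (x \<otimes>\<^bsub>group_ring (G Mod H)\<^esub> y))"
      by (simp add: coset_lift_mult(1) x y coset_lift_closed coset_proj_lift group_ring_cmul m_def)
    also have "coset_lift x + coset_lift y + \<dots>
        = coset_lift (x + y + frag_cmul (int m) (x \<otimes>\<^bsub>group_ring (G Mod H)\<^esub> y))"
      by (simp only: coset_lift_simps)
    finally show "u \<otimes>\<^bsub>group_ring G\<^esub> (frag_of \<one> + coset_lift y) = frag_of \<one>"
      by (simp add: xy)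
  next
    fix g assume g: "g \<in> carrier G"
    then have gQ: "frag_of (H #> g) \<in> carrier (group_ring (G Mod H))"
      by (auto simp: carrier_Mod)
    \<comment> \<open>Centrality of \<open>1 + m x\<close> only shows that \<open>m x\<close> is
      central; the factor \<open>m\<close> cancels because Z[G/A] is additively
      torsion-free.\<close>
    have "frag_cmul (int m) (x \<otimes>\<^bsub>group_ring (G Mod H)\<^esub> frag_of (H #> g))
        = frag_cmul (int m) (frag_of (H #> g) \<otimes>\<^bsub>group_ring (G Mod H)\<^esub> x)"
      using Q.central_unitsD(2)[OF vkC gQ] gQ unfolding vk_def vk
      by (simp add: group_ring_distrib group_ring_cmul del: one_FactGroup mult_FactGroup)
    then have "x \<otimes>\<^bsub>group_ring (G Mod H)\<^esub> frag_of (H #> g)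
        = frag_of (H #> g) \<otimes>\<^bsub>group_ring (G Mod H)\<^esub> x"
      using \<open>m > 0\<close> by (auto dest: frag_cmul_cancel)
    then show "u \<otimes>\<^bsub>group_ring G\<^esub> frag_of g = frag_of g \<otimes>\<^bsub>group_ring G\<^esub> u"
      using g x by (simp add: u_def group_ring_distrib coset_lift_mult)
  qed
  moreover have "coset_proj G H u = v [^]\<^bsub>central_unit_group (G Mod H)\<^esub> k"
    using x by (simp add: u_def vk coset_proj_lift m_def coset_mult_one[OF subset])
  ultimately show ?thesis
    using k that by blast
qed

section \<open>The product of the augmentation ideals and the kernel of the projection\<close>

definition coset_ideal where
  "coset_ideal = additive_product (group_ring G) (augmentation_ideal G)
    (augmentation_ideal (G\<lparr>carrier := H\<rparr>))"

text \<open>On Z[A] the projection is the augmentation times the identity, so it kills the second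
  factor of each generator, and by multiplicativity the generator.\<close>

lemma coset_proj_coset_ideal:
  assumes "p \<in> coset_ideal"
  shows "coset_proj G H p = 0"
proof -
  interpret R: ring "group_ring G"
    by (rule ring_group_ring)
  interpret Q: group "G Mod H"
    by (rule group_Mod)
  let ?S = "{x \<otimes>\<^bsub>group_ring G\<^esub> y |x y. x \<in> augmentation_ideal G \<and>
      y \<in> augmentation_ideal (G\<lparr>carrier := H\<rparr>)}"
  have y: "coset_proj G H y = frag_cmul (augmentation y) (frag_of \<one>\<^bsub>G Mod H\<^esub>)"
    if "y \<in> carrier (group_ring (G\<lparr>carrier := H\<rparr>))" for y
    using that
    by (induction rule: group_ring_induct)
      (auto simp: coset_join2[OF _ is_subgroup] augmentation_diff frag_cmul_diff_distrib)
  have S: "s \<in> carrier (group_ring G) \<and> coset_proj G H s = 0" if "s \<in> ?S" for s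
  proof -
    from that obtain x y where xy: "s = x \<otimes>\<^bsub>group_ring G\<^esub> y" "x \<in> augmentation_ideal G"
      "y \<in> augmentation_ideal (G\<lparr>carrier := H\<rparr>)"
      by (elim CollectE exE conjE)
    then have "x \<in> carrier (group_ring G)" "y \<in> carrier (group_ring G)"
      using subset by (auto simp: augmentation_ideal_def carrier_group_ring)
    moreover have "coset_proj G H y = 0"
      using xy(3) y by (simp add: augmentation_ideal_def)
    ultimately show ?thesis
      by (simp add: xy(1) coset_proj_mult)
  qed
  have "p \<in> generate (add_monoid (group_ring G)) ?S"
    using assms by (simp add: coset_ideal_def additive_product_def)
  then show ?thesis
  proof induction
    case (inv s)
    have "\<ominus>\<^bsub>group_ring G\<^esub> s = - s"
      using S[OF inv] by (intro R.minus_equality) auto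
    then show ?case
      using S[OF inv] by (simp add: a_inv_def)
  qed (use S in auto)
qed

text \<open>Summing \<open>(- y) (a - 1)\<close> over \<open>a\<close> in A gives
  \<open>|A| y\<close> minus \<open>y\<close> times the sum of A. The latter product is the lift of
  the projection of \<open>y\<close>, hence 0. That \<open>- y\<close> lies in the augmentation
  ideal holds because the augmentation factors through the projection.\<close>

lemma cmul_kernel_in_coset_ideal:
  assumes fin: "finite (carrier G)"
    and y: "y \<in> carrier (group_ring G)" "coset_proj G H y = 0"
  shows "frag_cmul (int (card H)) y \<in> coset_ideal"
proof -
  interpret Q: group "G Mod H"
    by (rule group_Mod)
  let ?S = "{x \<otimes>\<^bsub>group_ring G\<^esub> y |x y. x \<in> augmentation_ideal G \<and>
      y \<in> augmentation_ideal (G\<lparr>carrier := H\<rparr>)}"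
  let ?t = "\<lambda>a. (- y) \<otimes>\<^bsub>group_ring G\<^esub> (frag_of a - frag_of \<one>)"
  have "augmentation y = 0"
    using augmentation_coset_proj[of G H y] y by simp
  then have yD: "- y \<in> augmentation_ideal G"
    using y by (simp add: augmentation_ideal_def augmentation_minus)
  have t: "?t a \<in> ?S" if "a \<in> H" for a
  proof -
    have "frag_of a - frag_of \<one> \<in> augmentation_ideal (G\<lparr>carrier := H\<rparr>)"
      using that by (simp add: augmentation_ideal_def augmentation_diff)
    with yD show ?thesis
      by blast
  qed
  have "(\<Sum>a\<in>I. ?t a) \<in> coset_ideal" if "finite I" "I \<subseteq> H" for I
    using that
  proof (induction I rule: finite_induct)
    case empty
    show ?case
      using generate.one[of "add_monoid (group_ring G)" ?S]
      by (simp add: coset_ideal_def additive_product_def)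
  next
    case (insert a I)
    then show ?case
      using generate.eng[OF generate.incl[OF t[of a], of "add_monoid (group_ring G)"], of "\<Sum>a\<in>I. ?t a"]
      by (simp add: coset_ideal_def additive_product_def)
  qed
  then have "(\<Sum>a\<in>H. ?t a) \<in> coset_ideal"
    using finite_subset[OF subset fin] by blast
  also have "(\<Sum>a\<in>H. ?t a) = (- y) \<otimes>\<^bsub>group_ring G\<^esub> coset_lift (frag_of H)
      + (\<Sum>a\<in>H. y)"
    using y by (simp add: group_ring_diff group_ring_minus group_ring_sum sum_subtractf sum_negf)
  also have "(- y) \<otimes>\<^bsub>group_ring G\<^esub> coset_lift (frag_of H) = 0"
    using y coset_lift_mult(1)[of "- y" "frag_of \<one>\<^bsub>G Mod H\<^esub>"] Q.one_closed
    by (simp add: del: Q.one_closed)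
  also have "0 + (\<Sum>a\<in>H. y) = frag_cmul (int (card H)) y"
    by (rule poly_mapping_eqI) (simp add: lookup_frag_sum)
  finally show ?thesis .
qed

lemma one_plus_coset_ideal:
  "\<one>\<^bsub>group_ring G\<^esub> <+\<^bsub>group_ring G\<^esub>
        additive_product (group_ring G) (augmentation_ideal G)
          (augmentation_ideal (G\<lparr>carrier := H\<rparr>)) = {frag_of \<one> + p |p. p \<in> coset_ideal}"
  unfolding coset_ideal_def[symmetric] by (auto simp: a_l_coset_def' one_group_ring)

text \<open>Projecting \<open>1 + |A| y\<close> to 1 forces \<open>|A|\<close> times the image of
  \<open>y\<close> to vanish, hence the image itself, and the previous inclusion applies to
  \<open>y\<close>.\<close>

lemma kernel_pow_in_coset_ideal:
  assumes fin: "finite (carrier G)" and u: "u \<in> central_units G"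
    and ker: "coset_proj G H u = frag_of \<one>\<^bsub>G Mod H\<^esub>"
  obtains k :: nat and p where "k > 0" "p \<in> coset_ideal"
    "u [^]\<^bsub>central_unit_group G\<^esub> k = frag_of \<one> + p"
proof -
  interpret \<pi>: group_hom "central_unit_group G" "central_unit_group (G Mod H)" "coset_proj G H"
    by (rule coset_proj_group_hom)
  have m: "card H > 0"
    using fin by (rule card_pos)
  obtain k :: nat and y where k: "k > 0" and y: "y \<in> carrier (group_ring G)"
    and uk: "u [^]\<^bsub>central_unit_group G\<^esub> k = frag_of \<one> + frag_cmul (int (card H)) y"
    by (rule central_unit_pow_cong[OF fin u m])
  have "coset_proj G H (u [^]\<^bsub>central_unit_group G\<^esub> k) = frag_of \<one>\<^bsub>G Mod H\<^esub>"
    using \<pi>.hom_nat_pow[of u k] u ker \<pi>.H.nat_pow_one[of k] by simp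
  then have "coset_proj G H y = 0"
    unfolding uk using m by (simp add: coset_mult_one[OF subset])
  with k uk show ?thesis
    by (intro that[OF k cmul_kernel_in_coset_ideal[OF fin y]])
qed

end

section \<open>Torsion central units\<close>

context group
begin

interpretation C: comm_group "central_unit_group G"
  by (rule comm_group_central_units)

section \<open>The involution of the group ring and its trace form\<close>

definition star :: "('a \<Rightarrow>\<^sub>0 int) \<Rightarrow> ('a \<Rightarrow>\<^sub>0 int)" where
  "star = frag_extend (\<lambda>x. frag_of (inv x))"

lemma star_simps [simp]:
  "star (frag_of x) = frag_of (inv x)"
  "star 0 = 0"
  "star (f - g) = star f - star g"
  "star (f + g) = star f + star g"
  by (simp_all add: star_def frag_extend_diff frag_extend_add)

lemma star_closed [simp]: "f \<in> carrier (group_ring G) \<Longrightarrow> star f \<in> carrier (group_ring G)"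
  unfolding star_def by (rule frag_extend_in_group_ring) auto

lemma star_star [simp]: "f \<in> carrier (group_ring G) \<Longrightarrow> star (star f) = f"
  by (induction rule: group_ring_induct) auto

lemma star_mult:
  assumes f: "f \<in> carrier (group_ring G)" and g: "g \<in> carrier (group_ring G)"
  shows "star (f \<otimes>\<^bsub>group_ring G\<^esub> g) = star g \<otimes>\<^bsub>group_ring G\<^esub> star f"
  using g
proof (induction rule: group_ring_induct)
  case (one y)
  show ?case
    using f by (induction rule: group_ring_induct)
      (use one in \<open>auto simp: group_ring_diff inv_mult_group\<close>)
qed (auto simp: group_ring_diff)

lemma star_central_units:
  assumes u: "u \<in> central_units G"
  shows "star u \<in> central_units G"
proof (rule central_unitsI)
  note v = central_unit_inv[OF u] central_unitsD(1)[OF central_unit_inv(1)[OF u]]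
  show "star u \<in> carrier (group_ring G)"
    using central_unitsD(1)[OF u] by simp
  show "star (inv\<^bsub>central_unit_group G\<^esub> u) \<in> carrier (group_ring G)"
    using v by simp
  show "star u \<otimes>\<^bsub>group_ring G\<^esub> star (inv\<^bsub>central_unit_group G\<^esub> u) = frag_of \<one>"
    using v central_unitsD(1)[OF u] by (simp flip: star_mult)
  fix x assume x: "x \<in> carrier G"
  then have "star (frag_of (inv x) \<otimes>\<^bsub>group_ring G\<^esub> u) = star (u \<otimes>\<^bsub>group_ring G\<^esub> frag_of (inv x))"
    using central_unitsD(2)[OF u, of "frag_of (inv x)"] by simp
  then show "star u \<otimes>\<^bsub>group_ring G\<^esub> frag_of x = frag_of x \<otimes>\<^bsub>group_ring G\<^esub> star u"
    using central_unitsD(1)[OF u] x by (simp add: star_mult)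
qed

text \<open>The coefficient at the identity turns \<open>star\<close> into an adjoint: the resulting
  form is the inner product for which the group elements are orthonormal, and so it is positive
  definite.\<close>

lemma trace_star_mult:
  assumes fin: "finite (carrier G)"
    and f: "f \<in> carrier (group_ring G)" and g: "g \<in> carrier (group_ring G)"
  shows "Poly_Mapping.lookup (star f \<otimes>\<^bsub>group_ring G\<^esub> g) \<one>
    = (\<Sum>x\<in>carrier G. Poly_Mapping.lookup f x * Poly_Mapping.lookup g x)"
  using f
proof (induction rule: group_ring_induct)
  case (one x)
  have "Poly_Mapping.lookup (frag_of (inv x) \<otimes>\<^bsub>group_ring G\<^esub> g) \<one> = Poly_Mapping.lookup g x"
    using g
  proof (induction rule: group_ring_induct)
    case (one y)
    then have "\<one> = inv x \<otimes> y \<longleftrightarrow> x = y"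
      using \<open>x \<in> carrier G\<close> inv_solve_left[of \<one> x y] by auto
    then show ?case
      by simp
  qed (auto simp: group_ring_diff lookup_minus)
  also have "\<dots> = (\<Sum>z\<in>carrier G. if z = x then Poly_Mapping.lookup g z else 0)"
    using fin one by simp
  also have "\<dots> = (\<Sum>z\<in>carrier G. Poly_Mapping.lookup (frag_of x) z * Poly_Mapping.lookup g z)"
    by (intro sum.cong) auto
  finally show ?case
    by simp
qed (auto simp: group_ring_diff lookup_minus left_diff_distrib sum_subtractf)

lemma trace_star_self_nonneg:
  assumes "finite (carrier G)" "f \<in> carrier (group_ring G)"
  shows "Poly_Mapping.lookup (star f \<otimes>\<^bsub>group_ring G\<^esub> f) \<one> \<ge> 0"
  using assms by (simp add: trace_star_mult sum_nonneg)

lemma trace_star_self_eq_0: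
  assumes fin: "finite (carrier G)" and f: "f \<in> carrier (group_ring G)"
    and 0: "Poly_Mapping.lookup (star f \<otimes>\<^bsub>group_ring G\<^esub> f) \<one> = 0"
  shows "f = 0"
proof (rule poly_mapping_eqI)
  fix x
  have "\<forall>x\<in>carrier G. Poly_Mapping.lookup f x * Poly_Mapping.lookup f x = 0"
    using 0 fin by (simp add: trace_star_mult[OF fin f f] sum_nonneg_eq_0_iff)
  then show "Poly_Mapping.lookup f x = Poly_Mapping.lookup 0 x"
    using f by (cases "x \<in> carrier G") (auto simp: carrier_group_ring in_keys_iff)
qed

text \<open>For \<open>w = u\<^sup>*u\<close> with \<open>w\<^sup>n = 1\<close>, the sum \<open>1 + w + \<dots> + w\<^sup>n\<^sup>-\<^sup>1\<close> annihilates
  \<open>w - 1\<close>, but it acts as a positive definite operator because \<open>w\<^sup>k = (u\<^sup>k)\<^sup>*u\<^sup>k\<close>.\<close>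

lemma torsion_central_unit_star:
  assumes fin: "finite (carrier G)" and u: "u \<in> central_units G" and n: "n > 0"
    and tor: "u [^]\<^bsub>central_unit_group G\<^esub> (n::nat) = frag_of \<one>"
  shows "star u \<otimes>\<^bsub>group_ring G\<^esub> u = frag_of \<one>"
proof -
  let ?pow = "\<lambda>x i::nat. x [^]\<^bsub>central_unit_group G\<^esub> i"
  note D = central_unitsD(1)
  note su = star_central_units[OF u]
  define w where "w = star u \<otimes>\<^bsub>group_ring G\<^esub> u"
  have w: "w \<in> central_units G"
    unfolding w_def using C.m_closed[of "star u" u] u su by simp
  have pow: "?pow x k \<in> central_units G" if "x \<in> central_units G" for x k
    using C.nat_pow_closed[of x k] that by simp
  have star_pow: "star (?pow u k) = ?pow (star u) k" for k
  proof (induction k)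
    case (Suc k)
    have "star (?pow u (Suc k)) = star u \<otimes>\<^bsub>group_ring G\<^esub> ?pow (star u) k"
      using Suc pow[OF u] u by (simp add: star_mult D)
    also have "\<dots> = ?pow (star u) (Suc k)"
      using central_unitsD(2)[OF su, of "?pow (star u) k"] pow[OF su] by (simp add: D)
    finally show ?case .
  qed auto
  have w_pow: "?pow w k = star (?pow u k) \<otimes>\<^bsub>group_ring G\<^esub> ?pow u k" for k
    unfolding w_def star_pow using C.pow_mult_distrib[of "star u" u k] C.m_comm[of "star u" u] u su
    by simp
  define y where "y = w - frag_of \<one>"
  have y: "y \<in> carrier (group_ring G)"
    using w by (simp add: y_def D)
  define S where "S = (\<Sum>k<n. ?pow w k)"
  have "S \<otimes>\<^bsub>group_ring G\<^esub> y = (\<Sum>k<n. ?pow w (Suc k) - ?pow w k)"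
    unfolding S_def group_ring_sum using pow[OF w] by (simp add: y_def group_ring_diff D)
  also have "\<dots> = ?pow w n - ?pow w 0"
    by (rule sum_lessThan_telescope)
  also have "\<dots> = 0"
    by (simp add: w_pow tor)
  finally have "S \<otimes>\<^bsub>group_ring G\<^esub> y = 0" .
  moreover have "star y \<otimes>\<^bsub>group_ring G\<^esub> (S \<otimes>\<^bsub>group_ring G\<^esub> y)
      = (\<Sum>k<n. star (?pow u k \<otimes>\<^bsub>group_ring G\<^esub> y) \<otimes>\<^bsub>group_ring G\<^esub> (?pow u k \<otimes>\<^bsub>group_ring G\<^esub> y))"
    unfolding S_def group_ring_sum w_pow
    using y D[OF pow[OF u]] by (simp add: star_mult group_ring_assoc)
  ultimately have "(\<Sum>k<n. Poly_Mapping.lookup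
      (star (?pow u k \<otimes>\<^bsub>group_ring G\<^esub> y) \<otimes>\<^bsub>group_ring G\<^esub> (?pow u k \<otimes>\<^bsub>group_ring G\<^esub> y)) \<one>) = 0"
    by (simp flip: lookup_frag_sum)
  moreover have "0 \<le> Poly_Mapping.lookup
      (star (?pow u k \<otimes>\<^bsub>group_ring G\<^esub> y) \<otimes>\<^bsub>group_ring G\<^esub> (?pow u k \<otimes>\<^bsub>group_ring G\<^esub> y)) \<one>" for k
    using y D[OF pow[OF u]] by (intro trace_star_self_nonneg fin) auto
  ultimately have "\<forall>k\<in>{..<n}. Poly_Mapping.lookup
      (star (?pow u k \<otimes>\<^bsub>group_ring G\<^esub> y) \<otimes>\<^bsub>group_ring G\<^esub> (?pow u k \<otimes>\<^bsub>group_ring G\<^esub> y)) \<one> = 0"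
    by (subst (asm) sum_nonneg_eq_0_iff) auto
  \<comment> \<open>Positivity kills every summand. The one with \<open>k = 0\<close>, present
    because \<open>n > 0\<close>, is the squared norm of \<open>y\<close> itself.\<close>
  then have "Poly_Mapping.lookup
      (star (?pow u 0 \<otimes>\<^bsub>group_ring G\<^esub> y) \<otimes>\<^bsub>group_ring G\<^esub> (?pow u 0 \<otimes>\<^bsub>group_ring G\<^esub> y)) \<one> = 0"
    using n by blast
  then have "y = 0"
    using y by (intro trace_star_self_eq_0[OF fin]) auto
  then show ?thesis
    by (simp add: y_def w_def)
qed

text \<open>Reading \<open>star u\<close> times \<open>u\<close> equal to 1 at the identity says
  that the squares of the integer coefficients sum to 1, so exactly one coefficient is non-zero and
  it is 1 or -1. Centrality of \<open>u\<close> then passes to the group element, whatever the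
  sign.\<close>

lemma torsion_central_unit_trivial:
  assumes fin: "finite (carrier G)" and u: "u \<in> central_units G" and n: "n > 0"
    and tor: "u [^]\<^bsub>central_unit_group G\<^esub> (n::nat) = frag_of \<one>"
  shows "u \<in> trivial_central_units G"
proof -
  let ?c = "Poly_Mapping.lookup u"
  have uR: "u \<in> carrier (group_ring G)"
    using u by (rule central_unitsD(1))
  have sum1: "(\<Sum>x\<in>carrier G. ?c x * ?c x) = 1"
    using trace_star_mult[OF fin uR uR] torsion_central_unit_star[OF fin u n tor] by simp
  have "\<not> (\<forall>x\<in>carrier G. ?c x = 0)"
  proof
    assume "\<forall>x\<in>carrier G. ?c x = 0"
    then have "(\<Sum>x\<in>carrier G. ?c x * ?c x) = 0"
      by (intro sum.neutral) auto
    with sum1 show False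
      by simp
  qed
  then obtain g where g: "g \<in> carrier G" "?c g \<noteq> 0"
    by blast
  have pos: "1 \<le> ?c g * ?c g"
    using g(2) by (simp add: int_one_le_iff_zero_less zero_less_mult_iff linorder_neq_iff disj_commute)
  have "(\<Sum>x\<in>carrier G. ?c x * ?c x) = ?c g * ?c g + (\<Sum>x\<in>carrier G - {g}. ?c x * ?c x)"
    using fin g(1) by (rule sum.remove)
  moreover have ge: "(\<Sum>x\<in>carrier G - {g}. ?c x * ?c x) \<ge> 0"
    by (intro sum_nonneg) auto
  ultimately have c1: "?c g * ?c g = 1" and "(\<Sum>x\<in>carrier G - {g}. ?c x * ?c x) = 0"
    using pos sum1 by linarith+
  then have "\<forall>x\<in>carrier G - {g}. ?c x * ?c x = 0"
    using fin by (subst (asm) sum_nonneg_eq_0_iff) auto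
  then have "?c x = 0" if "x \<noteq> g" for x
    using that uR by (cases "x \<in> carrier G") (auto simp: carrier_group_ring in_keys_iff)
  then have "u = frag_cmul (?c g) (frag_of g)"
    by (intro poly_mapping_eqI) simp
  moreover have "?c g = 1 \<or> ?c g = -1"
    using c1 by (simp add: square_eq_1_iff)
  ultimately have eq: "u = frag_of g \<or> u = - frag_of g"
    by (metis frag_cmul_one frag_cmul_minus_one)
  have "g \<otimes> x = x \<otimes> g" if x: "x \<in> carrier G" for x
  proof -
    have "frag_of g \<otimes>\<^bsub>group_ring G\<^esub> frag_of x = frag_of x \<otimes>\<^bsub>group_ring G\<^esub> frag_of g"
      using eq central_unitsD(2)[OF u, of "frag_of x"] x
      by (auto simp: group_ring_minus simp del: frag_of_mult)
    then show ?thesis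
      by (simp add: frag_of_eq)
  qed
  with g(1) have "g \<in> center G"
    by (simp add: center_def)
  with eq show ?thesis
    by (auto simp: trivial_central_units_def)
qed

lemma trivial_central_unit_torsion:
  assumes fin: "finite (carrier G)" and u: "u \<in> trivial_central_units G"
  obtains n :: nat where "n > 0" "u [^]\<^bsub>central_unit_group G\<^esub> n = frag_of \<one>"
proof
  obtain z and s :: int where z: "z \<in> carrier G" and s: "s = 1 \<or> s = -1"
    and u_eq: "u = frag_cmul s (frag_of z)"
  proof -
    from u obtain z where "z \<in> carrier G" "u = frag_of z \<or> u = - frag_of z"
      unfolding trivial_central_units_def center_def by blast
    then show thesis
      using that[of z 1] that[of z "-1"] by auto
  qed
  have "u [^]\<^bsub>central_unit_group G\<^esub> k = frag_cmul (s ^ k) (frag_of (z [^] k))" for k :: nat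
    by (induction k) (simp_all add: u_eq group_ring_cmul mult.commute)
  \<comment> \<open>The exponent is twice the group order: the order kills \<open>z\<close>, the
    factor 2 kills the sign.\<close>
  moreover have "z [^] (2 * card (carrier G)) = \<one>"
    using pow_order_eq_1[OF z, unfolded Coset.order_def] z nat_pow_pow[of z "card (carrier G)" 2] by (simp add: mult.commute)
  moreover have "s ^ (2 * card (carrier G)) = 1"
    using s by (auto simp: power_mult)
  ultimately show "u [^]\<^bsub>central_unit_group G\<^esub> (2 * card (carrier G)) = frag_of \<one>"
    by simp
  show "2 * card (carrier G) > 0"
    using fin z by (auto simp: card_gt_0_iff)
qed

end

section \<open>Independent elements and logarithms\<close>

lemma (in comm_group) finprod_int_pow_diff:
  assumes "finite S" "f ` S \<subseteq> carrier G"
    and eq: "finprod G (\<lambda>s. f s [^] (a s :: int)) S = finprod G (\<lambda>s. f s [^] (b s :: int)) S"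
  shows "finprod G (\<lambda>s. f s [^] (a s - b s)) S = \<one>"
proof -
  have car: "(\<lambda>s. f s [^] (c s :: int)) \<in> S \<rightarrow> carrier G" for c
    using assms(2) by auto
  have "finprod G (\<lambda>s. f s [^] (a s - b s)) S \<otimes> finprod G (\<lambda>s. f s [^] b s) S
      = finprod G (\<lambda>s. f s [^] (a s - b s) \<otimes> f s [^] b s) S"
    by (rule finprod_multf[symmetric]) (use car in auto)
  also have "\<dots> = finprod G (\<lambda>s. f s [^] a s) S"
    using assms(2) by (intro finprod_cong') (auto simp: image_subset_iff simp flip: int_pow_mult)
  also have "\<dots> = \<one> \<otimes> finprod G (\<lambda>s. f s [^] b s) S"
    using car by (simp add: eq finprod_closed)
  finally show ?thesis
    by (subst (asm) r_cancel) (use car in \<open>auto intro!: finprod_closed\<close>)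
qed

lemma card_le_fibres:
  assumes "finite D" "\<And>x. x \<in> D \<Longrightarrow> card {y \<in> D. b y = b x} \<le> (N::nat)" "b ` D \<subseteq> T" "finite T"
  shows "card D \<le> N * card T"
proof -
  have "card D = card (\<Union>t\<in>b ` D. {y \<in> D. b y = t})"
    by (rule arg_cong[of _ _ card]) auto
  also have "\<dots> \<le> (\<Sum>t\<in>b ` D. card {y \<in> D. b y = t})"
    using assms(1) by (intro card_UN_le) auto
  also have "\<dots> \<le> card (b ` D) * N"
    using assms(2) sum_bounded_above[of "b ` D" "\<lambda>t. card {y \<in> D. b y = t}" N] by auto
  also have "\<dots> \<le> card T * N"
    using card_mono[OF assms(4,3)] by simp
  finally show ?thesis
    by (simp add: mult.commute)
qed

text \<open>The \<open>(M + 1)\<^sup>d\<close> products of \<open>d\<close> independent elements with exponents in \<open>{0..M}\<close> have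
  logarithmic vectors in a box of side \<open>O(M)\<close>; if \<open>d\<close> exceeds the number of logarithms, some
  unit cube contains too many of them as \<open>M\<close> grows.\<close>

lemma card_independent_le:
  fixes L :: "'i \<Rightarrow> 'a \<Rightarrow> real"
  assumes "comm_group H" and I: "finite I"
    and L: "\<And>i x y. i \<in> I \<Longrightarrow> x \<in> carrier H \<Longrightarrow> y \<in> carrier H \<Longrightarrow> L i (x \<otimes>\<^bsub>H\<^esub> y) = L i x + L i y"
    and bounded: "finite {x \<in> carrier H. \<forall>i\<in>I. \<bar>L i x\<bar> \<le> 1}"
    and S: "int_independent H S"
  shows "card S \<le> card I"
proof (rule ccontr)
  interpret H: comm_group H
    by fact
  have SH: "S \<subseteq> carrier H" and fin: "finite S"
    and indep: "\<And>c :: _ \<Rightarrow> int. finprod H (\<lambda>x. x [^]\<^bsub>H\<^esub> c x) S = \<one>\<^bsub>H\<^esub> \<Longrightarrow> \<forall>x\<in>S. c x = 0"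
    using S by (auto simp: int_independent_def)
  define N where "N = card {x \<in> carrier H. \<forall>i\<in>I. \<bar>L i x\<bar> \<le> 1}"
  define c where "c = nat \<lceil>\<Sum>i\<in>I. \<Sum>s\<in>S. \<bar>L i s\<bar>\<rceil>"
  \<comment> \<open>The pigeonhole estimate ends in \<open>(M + 1) ^ Suc (card I) \<le> N * (2 * c +
    1) ^ card I * (M + 1) ^ card I\<close>. With this \<open>M\<close> it reads
    \<open>M + 1 \<le> M\<close> after cancellation.\<close>
  define M where "M = N * (2 * c + 1) ^ card I"
  define D where "D = (\<Pi>\<^sub>E s\<in>S. {0..M})"
  define U where "U e = finprod H (\<lambda>s. s [^]\<^bsub>H\<^esub> int (e s)) S" for e :: "'a \<Rightarrow> nat"
  define b where "b e = restrict (\<lambda>i. \<lfloor>L i (U e)\<rfloor>) I" for e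
  have car: "(\<lambda>s. s [^]\<^bsub>H\<^esub> int (e s)) \<in> S \<rightarrow> carrier H" for e
    using SH by auto
  have UH: "U e \<in> carrier H" for e
    unfolding U_def using car by (rule H.finprod_closed)
  have finD: "finite D"
    unfolding D_def by (intro finite_PiE fin) auto
  have injU: "e = e'" if "e \<in> D" "e' \<in> D" "U e = U e'" for e e'
  proof -
    have "finprod H (\<lambda>s. s [^]\<^bsub>H\<^esub> (int (e s) - int (e' s))) S = \<one>\<^bsub>H\<^esub>"
      using H.finprod_int_pow_diff[of S "\<lambda>s. s" "\<lambda>s. int (e s)" "\<lambda>s. int (e' s)"] that(3) fin SH
      by (simp add: U_def)
    then have "\<forall>s\<in>S. int (e s) - int (e' s) = 0"
      by (rule indep)
    then show ?thesis
      using that(1,2) unfolding D_def by (intro PiE_ext[of e S _ e']) auto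
  qed
  have L1: "L i \<one>\<^bsub>H\<^esub> = 0" if "i \<in> I" for i
    using L[OF that, of "\<one>\<^bsub>H\<^esub>" "\<one>\<^bsub>H\<^esub>"] by simp
  have Lpow: "L i (x [^]\<^bsub>H\<^esub> int n) = real n * L i x" if "i \<in> I" "x \<in> carrier H" for i x n
  proof -
    have "L i (x [^]\<^bsub>H\<^esub> n) = real n * L i x"
      using that by (induction n) (simp_all add: L1 L algebra_simps)
    then show ?thesis
      by (simp add: int_pow_int)
  qed
  have Linv: "L i (inv\<^bsub>H\<^esub> x) = - L i x" if "i \<in> I" "x \<in> carrier H" for i x
    using L[OF that(1) H.inv_closed[OF that(2)] that(2)] L1[OF that(1)] that(2) by simp
  have LU: "L i (U e) = (\<Sum>s\<in>S. real (e s) * L i s)" if i: "i \<in> I" for i e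
    unfolding U_def using fin SH
  proof (induction S rule: finite_induct)
    case (insert s S)
    then have "(\<lambda>s. s [^]\<^bsub>H\<^esub> int (e s)) \<in> S \<rightarrow> carrier H"
      by auto
    with insert show ?case
      using i by (simp add: L Lpow H.finprod_closed)
  qed (simp add: L1 i)
  have bound: "\<bar>L i (U e)\<bar> \<le> real (M * c)" if i: "i \<in> I" and e: "e \<in> D" for i e
  proof -
    have "\<bar>L i (U e)\<bar> \<le> (\<Sum>s\<in>S. real (e s) * \<bar>L i s\<bar>)"
      unfolding LU[OF i] by (rule order_trans[OF sum_abs]) (simp add: abs_mult)
    also have "\<dots> \<le> (\<Sum>s\<in>S. real M * \<bar>L i s\<bar>)"
      using e by (intro sum_mono mult_right_mono) (auto simp: D_def PiE_def Pi_def)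
    also have "\<dots> = real M * (\<Sum>s\<in>S. \<bar>L i s\<bar>)"
      by (simp add: sum_distrib_left)
    also have "\<dots> \<le> real M * (\<Sum>i\<in>I. \<Sum>s\<in>S. \<bar>L i s\<bar>)"
      using i I by (intro mult_left_mono member_le_sum) (auto intro: sum_nonneg)
    also have "\<dots> \<le> real M * real c"
      unfolding c_def by (intro mult_left_mono) linarith+
    finally show ?thesis
      by simp
  qed
  define T where "T = (\<Pi>\<^sub>E i\<in>I. {- int (M * c)..int (M * c)})"
  have "b ` D \<subseteq> T"
  proof
    fix t assume "t \<in> b ` D"
    then obtain e where e: "e \<in> D" "t = b e"
      by auto
    have "- int (M * c) \<le> \<lfloor>L i (U e)\<rfloor> \<and> \<lfloor>L i (U e)\<rfloor> \<le> int (M * c)" if "i \<in> I" for i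
      using bound[OF that e(1)] by linarith
    then show "t \<in> T"
      by (auto simp: e b_def T_def)
  qed
  moreover have "finite T"
    unfolding T_def by (intro finite_PiE I) auto
  moreover have "card {y \<in> D. b y = b e} \<le> N" if e: "e \<in> D" for e
    unfolding N_def
  \<comment> \<open>Products with equal integer parts of logarithms differ by a factor with all
    logarithms in [-1, 1]. Dividing by \<open>U e\<close> thus embeds the fibre into the finite set
    counted by \<open>N\<close>.\<close>
  proof (rule card_inj_on_le[where f = "\<lambda>y. U y \<otimes>\<^bsub>H\<^esub> inv\<^bsub>H\<^esub> U e"])
    show "inj_on (\<lambda>y. U y \<otimes>\<^bsub>H\<^esub> inv\<^bsub>H\<^esub> U e) {y \<in> D. b y = b e}"
      using UH injU by (auto intro!: inj_onI)
    have "\<bar>L i (U y \<otimes>\<^bsub>H\<^esub> inv\<^bsub>H\<^esub> U e)\<bar> \<le> 1" if "b y = b e" "i \<in> I" for y i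
    proof -
      have "\<lfloor>L i (U y)\<rfloor> = \<lfloor>L i (U e)\<rfloor>"
        using fun_cong[OF that(1), of i] that(2) by (simp add: b_def)
      then have "\<bar>L i (U y) - L i (U e)\<bar> \<le> 1"
        by linarith
      then show ?thesis
        using that(2) UH by (simp add: L Linv)
    qed
    then show "(\<lambda>y. U y \<otimes>\<^bsub>H\<^esub> inv\<^bsub>H\<^esub> U e) ` {y \<in> D. b y = b e}
        \<subseteq> {x \<in> carrier H. \<forall>i\<in>I. \<bar>L i x\<bar> \<le> 1}"
      using UH by auto
  qed (rule bounded)
  ultimately have "card D \<le> N * card T"
    using finD by (intro card_le_fibres)
  moreover have "card D = (M + 1) ^ card S"
    by (simp add: D_def card_PiE fin)
  moreover have "card T = (2 * (M * c) + 1) ^ card I"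
    by (simp add: T_def card_PiE I nat_add_distrib nat_mult_distrib flip: of_nat_mult)
  moreover assume "\<not> card S \<le> card I"
  then have "(M + 1) ^ Suc (card I) \<le> (M + 1) ^ card S"
    by (intro power_increasing) auto
  moreover have "(2 * (M * c) + 1) ^ card I \<le> ((2 * c + 1) * (M + 1)) ^ card I"
    by (intro power_mono) (simp_all add: algebra_simps)
  ultimately have "(M + 1) ^ Suc (card I) \<le> N * ((2 * c + 1) * (M + 1)) ^ card I"
    by (metis (no_types, lifting) le_trans mult_le_mono2)
  also have "\<dots> = M * (M + 1) ^ card I"
    by (simp only: power_mult_distrib mult.assoc[symmetric] M_def[symmetric])
  finally show False
    by simp
qed

section \<open>Sums of eigenvectors\<close>

text \<open>Gaussian elimination. If some \<open>f j\<close> is non-zero at the new coordinate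
  \<open>x\<close>, subtracting multiples of it clears \<open>x\<close> from the other vectors; a
  dependence among those on the smaller \<open>Y\<close> extends to \<open>I\<close> by solving for
  the coefficient of \<open>j\<close>.\<close>

lemma ex_linear_dependence:
  fixes f :: "'i \<Rightarrow> 'x \<Rightarrow> 'k::field"
  assumes "finite Y" "finite I" "card Y < card I"
  shows "\<exists>c. (\<exists>i\<in>I. c i \<noteq> 0) \<and> (\<forall>x\<in>Y. (\<Sum>i\<in>I. c i * f i x) = 0)"
  using assms
proof (induction Y arbitrary: I f rule: finite_induct)
  case empty
  then obtain i where "i \<in> I"
    by fastforce
  then show ?case
    by (intro exI[of _ "\<lambda>_. 1"]) auto
next
  case (insert x Y)
  show ?case
  proof (cases "\<forall>i\<in>I. f i x = 0")
    case True
    obtain c where "\<exists>i\<in>I. c i \<noteq> 0" "\<forall>x\<in>Y. (\<Sum>i\<in>I. c i * f i x) = 0"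
      using insert.IH[of I f] insert.prems insert.hyps by auto
    with True show ?thesis
      by (intro exI[of _ c]) auto
  next
    case False
    then obtain j where j: "j \<in> I" "f j x \<noteq> 0"
      by blast
    define f' where "f' i y = f i y - f i x / f j x * f j y" for i y
    have "card Y < card (I - {j})"
      using insert.prems insert.hyps j by simp
    then obtain c where c: "\<exists>i\<in>I - {j}. c i \<noteq> 0"
        "\<forall>y\<in>Y. (\<Sum>i\<in>I - {j}. c i * f' i y) = 0"
      using insert.IH[of "I - {j}" f'] insert.prems by auto
    define d where "d = c(j := - (\<Sum>i\<in>I - {j}. c i * (f i x / f j x)))"
    have "(\<Sum>i\<in>I. d i * f i y) = (\<Sum>i\<in>I - {j}. c i * f' i y)" for y
    proof -
      have "(\<Sum>i\<in>I. d i * f i y) = d j * f j y + (\<Sum>i\<in>I - {j}. d i * f i y)"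
        using insert.prems(1) j(1) by (rule sum.remove)
      also have "(\<Sum>i\<in>I - {j}. d i * f i y) = (\<Sum>i\<in>I - {j}. c i * f i y)"
        by (intro sum.cong) (auto simp: d_def)
      also have "d j * f j y = - (\<Sum>i\<in>I - {j}. c i * (f i x / f j x * f j y))"
        by (simp add: d_def sum_distrib_right mult.assoc)
      also have "\<dots> + (\<Sum>i\<in>I - {j}. c i * f i y) = (\<Sum>i\<in>I - {j}. c i * f' i y)"
        by (simp add: f'_def right_diff_distrib sum_subtractf)
      finally show ?thesis .
    qed
    moreover have "f' i x = 0" for i
      using j(2) by (simp add: f'_def)
    moreover have "\<exists>i\<in>I. d i \<noteq> 0"
      using c(1) by (auto simp: d_def)
    ultimately show ?thesis
      using c(2) by (intro exI[of _ d]) auto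
  qed
qed

section \<open>Complex vectors, finite sums and polynomials in an operator\<close>

definition scale :: "complex \<Rightarrow> ('a \<Rightarrow> complex) \<Rightarrow> 'a \<Rightarrow> complex" where
  "scale c f = (\<lambda>z. c * f z)"

lemma scale_simps [simp]:
  "scale 0 f = 0" "scale c 0 = 0" "scale 1 f = f"
  "scale c (scale d f) = scale (c * d) f"
  by (auto simp: scale_def fun_eq_iff)

lemma scale_apply: "scale c f z = c * f z"
  by (simp add: scale_def)

lemma scale_distrib:
  "scale c (f + g) = scale c f + scale c g" "scale c (f - g) = scale c f - scale c g"
  "scale (c + d) f = scale c f + scale d f" "scale (c - d) f = scale c f - scale d f"
  by (auto simp: scale_def fun_eq_iff algebra_simps)

text \<open>Sums can stand for linear combinations because multiples of eigenvectors are
  eigenvectors. Lists keep repeated summands and provide an indexing for the eigenvalues.\<close>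

definition sums_of :: "'b::comm_monoid_add set \<Rightarrow> 'b set" where
  "sums_of E = sum_list ` lists E"

lemma sums_of_zero: "0 \<in> sums_of E"
  by (auto simp: sums_of_def intro!: image_eqI[of _ _ "[]"])

lemma sums_of_add: "e \<in> E \<Longrightarrow> f \<in> sums_of E \<Longrightarrow> e + f \<in> sums_of E"
  by (auto simp: sums_of_def intro!: image_eqI[of _ _ "e # ws" for ws])

lemma sums_of_induct [consumes 1, case_names zero add]:
  assumes "f \<in> sums_of E" "P 0"
    and "\<And>e f. e \<in> E \<Longrightarrow> f \<in> sums_of E \<Longrightarrow> P f \<Longrightarrow> P (e + f)"
  shows "P f"
proof -
  obtain ws where "set ws \<subseteq> E" "f = sum_list ws"
    using assms(1) by (auto simp: sums_of_def)
  moreover have "set ws \<subseteq> E \<Longrightarrow> P (sum_list ws)" for ws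
    by (induction ws) (use assms(2,3) in \<open>auto simp: sums_of_def lists_eq_set\<close>)
  ultimately show ?thesis
    by blast
qed

lemma sums_of_plus: "f \<in> sums_of E \<Longrightarrow> g \<in> sums_of E \<Longrightarrow> f + g \<in> sums_of E"
  by (induction rule: sums_of_induct) (auto simp: add.assoc intro: sums_of_add)

lemma sums_of_base: "e \<in> E \<Longrightarrow> e \<in> sums_of E"
  using sums_of_add[OF _ sums_of_zero] by fastforce

lemma sums_of_trans: "f \<in> sums_of E \<Longrightarrow> (\<And>e. e \<in> E \<Longrightarrow> e \<in> sums_of E') \<Longrightarrow> f \<in> sums_of E'"
  by (induction rule: sums_of_induct) (auto intro: sums_of_plus sums_of_zero)

lemma sums_of_closed:
  assumes "f \<in> sums_of E" "E \<subseteq> S" "0 \<in> S" "\<And>f g. f \<in> S \<Longrightarrow> g \<in> S \<Longrightarrow> f + g \<in> S"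
  shows "f \<in> S"
  using assms(1) by (induction rule: sums_of_induct) (use assms in auto)

text \<open>The zero vector belongs to every eigenspace; only non-zero summands have a well-defined
  eigenvalue.\<close>

lemma sums_of_list:
  assumes "f \<in> sums_of E"
  obtains ws where "set ws \<subseteq> E - {0}" "f = sum_list ws"
proof -
  from assms obtain ws where ws: "set ws \<subseteq> E" "f = sum_list ws"
    by (auto simp: sums_of_def)
  have "sum_list (removeAll 0 ws) = sum_list ws" for ws :: "'a list"
    by (induction ws) auto
  with ws show ?thesis
    by (intro that[of "removeAll 0 ws"]) auto
qed

definition poly_apply ::
  "(('a \<Rightarrow> complex) \<Rightarrow> 'a \<Rightarrow> complex) \<Rightarrow> complex poly \<Rightarrow> ('a \<Rightarrow> complex) \<Rightarrow> 'a \<Rightarrow> complex"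
  where "poly_apply T p v = (\<lambda>z. \<Sum>i\<le>degree p. coeff p i * ((T ^^ i) v) z)"

lemma poly_apply_ge:
  assumes "degree p \<le> n"
  shows "poly_apply T p v z = (\<Sum>i\<le>n. coeff p i * ((T ^^ i) v) z)"
  unfolding poly_apply_def using assms
  by (intro sum.mono_neutral_left) (auto simp: coeff_eq_0)

lemma poly_apply_pCons: "poly_apply T (pCons a p) v = scale a v + poly_apply T p (T v)"
proof
  fix z
  have "degree (pCons a p) \<le> Suc (degree p)"
    by (simp add: degree_pCons_le)
  then show "poly_apply T (pCons a p) v z = (scale a v + poly_apply T p (T v)) z"
    by (subst poly_apply_ge)
      (auto simp: poly_apply_def scale_def sum.atMost_Suc_shift funpow_swap1 simp del: sum.atMost_Suc)
qed

lemma poly_apply_diff: "poly_apply T (p - q) v = poly_apply T p v - poly_apply T q v"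
proof
  fix z
  have "degree (p - q) \<le> max (degree p) (degree q)"
    by (simp add: degree_diff_le_max)
  then show "poly_apply T (p - q) v z = (poly_apply T p v - poly_apply T q v) z"
    by (simp add: poly_apply_ge[of _ "max (degree p) (degree q)"] left_diff_distrib sum_subtractf)
qed

lemma poly_apply_smult: "poly_apply T (smult c p) v = scale c (poly_apply T p v)"
  by (rule ext) (simp add: poly_apply_ge[of _ "degree p"] scale_def sum_distrib_left mult.assoc
      degree_smult_le)

locale complex_linear =
  fixes T :: "('a \<Rightarrow> complex) \<Rightarrow> 'a \<Rightarrow> complex"
  assumes map_diff: "T (f - g) = T f - T g" and map_scale: "T (scale c f) = scale c (T f)"
begin

lemma map_zero: "T 0 = 0"
  using map_scale[of 0 0] by simp

lemma map_plus: "T (f + g) = T f + T g"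
proof -
  have "T (f - scale (-1) g) = T f - scale (-1) (T g)"
    by (simp add: map_diff map_scale)
  moreover have "f - scale (-1) g = f + g" for f g :: "'a \<Rightarrow> complex"
    by (auto simp: scale_def fun_eq_iff)
  ultimately show ?thesis
    by metis
qed

lemma pow_diff: "(T ^^ n) (f - g) = (T ^^ n) f - (T ^^ n) g"
  and pow_scale: "(T ^^ n) (scale c f) = scale c ((T ^^ n) f)"
  by (induction n) (simp_all add: map_diff map_scale)

lemma poly_apply_linear_factor:
  "poly_apply T ([:- a, 1:] * q) v = poly_apply T q (T v - scale a v)"
proof -
  have "[:- a, 1:] * q = pCons 0 q - smult a q"
    by simp
  then have "poly_apply T ([:- a, 1:] * q) v = poly_apply T q (T v) - scale a (poly_apply T q v)"
    by (simp only: poly_apply_diff poly_apply_pCons poly_apply_smult) simp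
  also have "\<dots> = poly_apply T q (T v - scale a v)"
    by (simp add: poly_apply_def fun_eq_iff pow_diff pow_scale scale_apply right_diff_distrib
        sum_subtractf sum_distrib_left mult.left_commute)
  finally show ?thesis .
qed

text \<open>The hypothesis \<open>ker\<close> says that all generalised eigenvectors of \<open>T\<close> in \<open>S\<close> are eigenvectors.\<close>

lemma sum_of_eigenvectors:
  assumes S: "0 \<in> S" "\<And>f g. f \<in> S \<Longrightarrow> g \<in> S \<Longrightarrow> f + g \<in> S"
    "\<And>f g. f \<in> S \<Longrightarrow> g \<in> S \<Longrightarrow> f - g \<in> S" "\<And>c f. f \<in> S \<Longrightarrow> scale c f \<in> S" "\<And>f. f \<in> S \<Longrightarrow> T f \<in> S"
    and ker: "\<And>a z w. z \<in> S \<Longrightarrow> w = T z - scale a z \<Longrightarrow> T w = scale a w \<Longrightarrow> w = 0"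
    and p: "p \<noteq> 0" "poly_apply T p v = 0" and v: "v \<in> S"
  shows "v \<in> sums_of {w \<in> S. \<exists>a. T w = scale a w}"
  using p v
proof (induction "degree p" arbitrary: p v)
  case 0
  then obtain c where c: "p = [:c:]" "c \<noteq> 0"
    using degree_0_id[of p] by (metis pCons_0_0)
  have "scale c v = 0"
    using 0 c by (simp add: poly_apply_def scale_def zero_fun_def)
  then have "v = 0"
    using c(2) by (auto simp: scale_def fun_eq_iff)
  show ?case
    unfolding \<open>v = 0\<close> by (rule sums_of_zero)
next
  case (Suc n)
  let ?E = "{w \<in> S. \<exists>a. T w = scale a w}"
  obtain a where "poly p a = 0"
    using Suc.hyps(2) fundamental_theorem_of_algebra[of p] by (auto simp: constant_degree)
  then obtain q where q: "p = [:- a, 1:] * q"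
    by (auto simp: poly_eq_0_iff_dvd)
  have "q \<noteq> 0"
    using q Suc.prems(1) by auto
  moreover have "degree q = n"
    using Suc.hyps(2) \<open>q \<noteq> 0\<close> unfolding q by (subst (asm) degree_mult_eq) auto
  moreover have "poly_apply T q (T v - scale a v) = 0"
    using Suc.prems(2) by (simp only: q poly_apply_linear_factor)
  ultimately have w: "T v - scale a v \<in> sums_of ?E"
    using Suc.prems(3) S by (intro Suc.hyps(1)) auto
  \<comment> \<open>An eigenvector \<open>e\<close> for \<open>b \<noteq> a\<close> is the image of
    \<open>e / (b - a)\<close> under \<open>T - a\<close>, while the eigenvectors for
    \<open>a\<close> are collected in \<open>w0\<close>.\<close>
  have "\<exists>v1\<in>sums_of ?E. \<exists>w0\<in>S. T w0 = scale a w0 \<and> w = T v1 - scale a v1 + w0"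
    if "w \<in> sums_of ?E" for w
    using that
  proof (induction rule: sums_of_induct)
    case zero
    show ?case
      by (intro bexI[of _ "0 :: 'a \<Rightarrow> complex"] conjI)
        (simp_all only: sums_of_zero S(1) map_zero scale_simps diff_0_right add_0_right)
  next
    case (add e f)
    then obtain v1 w0 b where vw: "v1 \<in> sums_of ?E" "w0 \<in> S" "T w0 = scale a w0"
      "f = T v1 - scale a v1 + w0" and e: "e \<in> S" "T e = scale b e"
      by blast
    show ?case
    proof (cases "b = a")
      case True
      show ?thesis
        by (rule bexI[OF _ vw(1)], rule bexI[of _ "e + w0"])
          (use vw e True S(2) in \<open>simp_all add: map_plus scale_distrib del: plus_fun_apply minus_apply\<close>)
    next
      case False
      let ?e = "scale (1 / (b - a)) e"
      have eE: "?e \<in> ?E"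
        using e S(4) by (auto simp: map_scale mult.commute)
      have "T ?e - scale a ?e = scale (b / (b - a) - a / (b - a)) e"
        by (simp add: map_scale e(2) scale_distrib(4) del: minus_apply)
      also have "b / (b - a) - a / (b - a) = 1"
        using False by (simp flip: diff_divide_distrib)
      also have "scale 1 e = e"
        by (rule scale_simps)
      finally have "e + f = (T ?e - scale a ?e) + (T v1 - scale a v1 + w0)"
        by (simp only: vw(4))
      also have "\<dots> = T (?e + v1) - scale a (?e + v1) + w0"
        unfolding map_plus scale_distrib by (simp only: algebra_simps)
      finally have "e + f = T (?e + v1) - scale a (?e + v1) + w0" .
      then show ?thesis
        using vw sums_of_add[OF eE vw(1)] by blast
    qed
  qed
  from this[OF w] obtain v1 w0 where vw: "v1 \<in> sums_of ?E" "w0 \<in> S" "T w0 = scale a w0"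
    "T v - scale a v = T v1 - scale a v1 + w0"
    by blast
  have v1S: "v1 \<in> S"
    using vw(1) by (rule sums_of_closed) (use S in auto)
  \<comment> \<open>So \<open>w0\<close> is an eigenvector for \<open>a\<close> that lies in the
    image of \<open>T - a\<close>. By \<open>ker\<close> it vanishes, and \<open>v - v1\<close> is
    itself an eigenvector.\<close>
  have eq: "w0 = T (v - v1) - scale a (v - v1)"
    using vw(4) by (simp add: map_diff scale_distrib algebra_simps)
  then have "w0 = 0"
    using S(3) Suc.prems(3) v1S vw(3) by (intro ker[of "v - v1" w0 a]) auto
  then have "v - v1 \<in> ?E"
    using eq S(3) Suc.prems(3) v1S by auto
  then have "v - v1 + v1 \<in> sums_of ?E"
    using vw(1) by (rule sums_of_add)
  then show ?case
    by simp
qed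

end

section \<open>Finite rank of the central units\<close>

lemma finite_bounded_frags:
  assumes "finite Y"
  shows "finite {f. Poly_Mapping.keys f \<subseteq> Y \<and> (\<forall>x\<in>Y. \<bar>Poly_Mapping.lookup f x\<bar> \<le> (B :: int))}" (is "finite ?F")
proof (rule finite_imageD)
  let ?r = "\<lambda>f. restrict (Poly_Mapping.lookup f) Y"
  have "?r ` ?F \<subseteq> (\<Pi>\<^sub>E x\<in>Y. {- B..B})"
    by (auto simp: abs_le_iff minus_le_iff)
  then show "finite (?r ` ?F)"
    by (rule finite_subset) (auto intro!: finite_PiE assms)
  show "inj_on ?r ?F"
  proof (rule inj_onI)
    fix f g assume fg: "f \<in> ?F" "g \<in> ?F" "?r f = ?r g"
    have "Poly_Mapping.lookup f x = Poly_Mapping.lookup g x" for x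
    proof (cases "x \<in> Y")
      case True
      then show ?thesis
        using fun_cong[OF fg(3), of x] by simp
    next
      case False
      then have "x \<notin> Poly_Mapping.keys f" "x \<notin> Poly_Mapping.keys g"
        using fg by auto
      then show ?thesis
        by (simp add: in_keys_iff)
    qed
    then show "f = g"
      by (rule poly_mapping_eqI)
  qed
qed

text \<open>The \<open>card Y + 1\<close> vectors obtained from \<open>v\<close> by applying
  \<open>T\<close> at most \<open>card Y\<close> times have only \<open>card Y\<close> coordinates,
  hence are dependent; the coefficients of a dependence form \<open>p\<close>.\<close>

lemma ex_annihilating_poly:
  assumes fin: "finite Y" and V: "\<And>i z. z \<notin> Y \<Longrightarrow> (T ^^ i) v z = 0"
  obtains p where "p \<noteq> 0" "poly_apply T p v = 0"
proof -
  let ?n = "card Y"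
  obtain c where c: "\<exists>i\<in>{..?n}. c i \<noteq> 0" "\<forall>x\<in>Y. (\<Sum>i\<in>{..?n}. c i * (T ^^ i) v x) = 0"
    using ex_linear_dependence[OF fin, of "{..?n}" "\<lambda>i. (T ^^ i) v"] by auto
  define p where "p = Poly (map c [0..<Suc ?n])"
  have coeff: "coeff p i = (if i \<le> ?n then c i else 0)" for i
    by (auto simp: p_def coeff_Poly_eq nth_default_def simp del: upt_Suc)
  then have "degree p \<le> ?n"
    by (intro degree_le) auto
  then have "poly_apply T p v z = 0" for z
    using c(2) V[of z] by (cases "z \<in> Y") (simp_all add: poly_apply_ge coeff)
  moreover have "p \<noteq> 0"
    using c(1) coeff by (metis atMost_iff coeff_0)
  ultimately show ?thesis
    by (intro that[of p]) auto
qed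

section \<open>The regular representation and its joint eigenvectors\<close>

locale finite_group = group +
  assumes fin: "finite (carrier G)"
begin

text \<open>A model of C[G]: the value 0 off the carrier makes equality of coefficients on G
  equality of functions.\<close>

definition V :: "('a \<Rightarrow> complex) set" where
  "V = {f. \<forall>z. z \<notin> carrier G \<longrightarrow> f z = 0}"

text \<open>Left multiplication by \<open>u\<close> on C[G], written as a convolution of coefficient
  functions.\<close>

definition act :: "('a \<Rightarrow>\<^sub>0 int) \<Rightarrow> ('a \<Rightarrow> complex) \<Rightarrow> 'a \<Rightarrow> complex" where
  "act u f = (\<lambda>z. if z \<in> carrier G
     then \<Sum>x\<in>carrier G. of_int (Poly_Mapping.lookup u x) * f (inv x \<otimes> z) else 0)"

definition inner :: "('a \<Rightarrow> complex) \<Rightarrow> ('a \<Rightarrow> complex) \<Rightarrow> complex" where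
  "inner f g = (\<Sum>z\<in>carrier G. f z * cnj (g z))"

lemma V_closed:
  "0 \<in> V" "f \<in> V \<Longrightarrow> g \<in> V \<Longrightarrow> f + g \<in> V" "f \<in> V \<Longrightarrow> g \<in> V \<Longrightarrow> f - g \<in> V"
  "f \<in> V \<Longrightarrow> scale c f \<in> V" "act u f \<in> V"
  by (auto simp: V_def act_def scale_def)

lemma act_diff_left: "act (u - v) f = act u f - act v f"
  by (auto simp: act_def fun_eq_iff lookup_minus left_diff_distrib sum_subtractf)

lemma act_zero_left: "act 0 f = 0"
  by (auto simp: act_def fun_eq_iff)

lemma act_frag_of:
  assumes "x \<in> carrier G"
  shows "act (frag_of x) f = (\<lambda>z. if z \<in> carrier G then f (inv x \<otimes> z) else 0)"
proof -
  have "(\<Sum>y\<in>carrier G. of_int (Poly_Mapping.lookup (frag_of x) y) * f (inv y \<otimes> z))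
      = (\<Sum>y\<in>carrier G. if y = x then f (inv x \<otimes> z) else 0)" for z
    by (intro sum.cong) auto
  then show ?thesis
    using assms fin by (simp add: act_def fun_eq_iff del: lookup_frag_of)
qed

lemma act_one: "f \<in> V \<Longrightarrow> act (frag_of \<one>) f = f"
  by (auto simp: act_frag_of fun_eq_iff V_def)

lemma act_cmul: "act (frag_cmul k u) f = scale (of_int k) (act u f)"
  by (auto simp: act_def fun_eq_iff scale_def sum_distrib_left mult.assoc)

sublocale act: complex_linear "act u" for u
  by unfold_locales
    (auto simp: act_def fun_eq_iff scale_def right_diff_distrib sum_subtractf sum_distrib_left
      mult.left_commute)

lemma act_mult:
  assumes u: "u \<in> carrier (group_ring G)" and v: "v \<in> carrier (group_ring G)"
  shows "act (u \<otimes>\<^bsub>group_ring G\<^esub> v) f = act u (act v f)"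
  using u
proof (induction rule: group_ring_induct)
  case (one x)
  show ?case
    using v
  proof (induction rule: group_ring_induct)
    case (one y)
    then show ?case
      using \<open>x \<in> carrier G\<close> by (auto simp: act_frag_of fun_eq_iff inv_mult_group m_assoc)
  qed (auto simp only: group_ring_diff group_ring_mult_zero act_diff_left act_zero_left
      act.map_diff act.map_zero)
qed (auto simp only: group_ring_diff group_ring_mult_zero act_diff_left act_zero_left)

lemma inner_diff_left: "inner (f - g) h = inner f h - inner g h"
  and inner_diff_right: "inner h (f - g) = inner h f - inner h g"
  and inner_scale_left: "inner (scale c f) h = c * inner f h"
  and inner_scale_right: "inner f (scale c h) = cnj c * inner f h"
  by (simp_all add: inner_def scale_def algebra_simps sum_subtractf sum_distrib_left)

lemma inner_zero: "inner 0 f = 0" "inner f 0 = 0"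
  by (simp_all add: inner_def)

lemma inner_self_eq_0:
  assumes "f \<in> V" "inner f f = 0"
  shows "f = 0"
proof
  fix z
  have "inner f f = of_real (\<Sum>z\<in>carrier G. (cmod (f z))\<^sup>2)"
    unfolding inner_def complex_norm_square of_real_sum by (rule refl)
  then have "(\<Sum>z\<in>carrier G. (cmod (f z))\<^sup>2) = 0"
    using assms(2) by (simp del: of_real_sum)
  then have "\<forall>z\<in>carrier G. cmod (f z) = 0"
    using fin by (simp add: sum_nonneg_eq_0_iff)
  then show "f z = 0 z"
    using assms(1) by (cases "z \<in> carrier G") (auto simp: V_def)
qed

text \<open>Left translation by \<open>x\<close> is unitary, so its adjoint is translation by
  \<open>inv x\<close>. This extends additively to Z[G], where no coefficient needs
  conjugating.\<close>

lemma inner_act: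
  assumes u: "u \<in> carrier (group_ring G)"
  shows "inner (act u f) g = inner f (act (star u) g)"
  using u
proof (induction rule: group_ring_induct)
  case (one x)
  have "(\<Sum>z\<in>carrier G. f (inv x \<otimes> z) * cnj (g z)) = (\<Sum>z\<in>carrier G. f z * cnj (g (x \<otimes> z)))"
    by (rule sum.reindex_bij_witness[of _ "\<lambda>z. x \<otimes> z" "\<lambda>z. inv x \<otimes> z"])
      (use one in \<open>auto simp flip: m_assoc\<close>)
  then show ?case
    using one by (simp add: inner_def act_frag_of)
qed (simp_all only: star_simps act_diff_left act_zero_left inner_diff_left inner_diff_right inner_zero)

text \<open>The operators of elements commuting with their adjoints are normal.\<close>

lemma act_no_generalised_eigenvectors:
  assumes u: "u \<in> carrier (group_ring G)"
    and comm: "u \<otimes>\<^bsub>group_ring G\<^esub> star u = star u \<otimes>\<^bsub>group_ring G\<^esub> u"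
    and w: "w = act u z - scale a z" "act u w = scale a w" and z: "z \<in> V"
  shows "w = 0"
proof -
  have wV: "w \<in> V"
    unfolding w(1) using z by (intro V_closed)
  \<comment> \<open>Since the two operators commute, \<open>y\<close> is again an eigenvector of
    \<open>act u\<close> for \<open>a\<close>. Moving \<open>u - a\<close> across the form gives
    \<open>inner y y = 0\<close>, and then \<open>inner w w = inner z y = 0\<close>.\<close>
  define y where "y = act (star u) w - scale (cnj a) w"
  have yV: "y \<in> V"
    unfolding y_def using wV by (intro V_closed)
  have adj: "inner (act u f - scale a f) g = inner f (act (star u) g - scale (cnj a) g)" for f g
    using u by (simp add: inner_diff_left inner_diff_right inner_act inner_scale_left
        inner_scale_right del: minus_apply)
  have "act u (act (star u) w) = act (star u) (act u w)"
    using comm u by (simp flip: act_mult)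
  then have "act u y - scale a y = 0"
    unfolding y_def act.map_diff act.map_scale w(2) scale_distrib scale_simps
    by (simp only: mult.commute diff_self)
  then have "inner y y = 0"
    using adj[of y w] by (simp add: y_def inner_zero del: minus_apply)
  then have "y = 0"
    using yV by (rule inner_self_eq_0[rotated])
  then have "inner w w = 0"
    using adj[of z w] by (simp only: w(1)[symmetric] y_def[symmetric] inner_zero)
  then show ?thesis
    using wV by (rule inner_self_eq_0[rotated])
qed

definition joint_eigenvectors :: "('a \<Rightarrow>\<^sub>0 int) set \<Rightarrow> ('a \<Rightarrow> complex) set" where
  "joint_eigenvectors Y = {w \<in> V. \<forall>u\<in>Y. \<exists>a. act u w = scale a w}"

text \<open>Each joint eigenvector \<open>e\<close> for \<open>Y\<close> is split further by
  \<open>u\<close>. The splitting takes place inside the space \<open>S\<close> of vectors having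
  the same eigenvalues as \<open>e\<close>, which \<open>act u\<close> preserves by commutativity,
  so the parts remain eigenvectors for \<open>Y\<close>.\<close>

lemma sum_of_joint_eigenvectors:
  assumes "finite Y" "Y \<subseteq> carrier (group_ring G)"
    and "\<And>u v. u \<in> Y \<Longrightarrow> v \<in> Y \<Longrightarrow> u \<otimes>\<^bsub>group_ring G\<^esub> v = v \<otimes>\<^bsub>group_ring G\<^esub> u"
    and "\<And>u. u \<in> Y \<Longrightarrow> u \<otimes>\<^bsub>group_ring G\<^esub> star u = star u \<otimes>\<^bsub>group_ring G\<^esub> u"
    and v: "v \<in> V"
  shows "v \<in> sums_of (joint_eigenvectors Y)"
  using assms(1-4)
proof (induction Y rule: finite_induct)
  case empty
  show ?case
    using v by (intro sums_of_base) (auto simp: joint_eigenvectors_def)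
next
  case (insert u Y)
  have u: "u \<in> carrier (group_ring G)"
    using insert.prems(1) by simp
  have "v \<in> sums_of (joint_eigenvectors Y)"
    using insert by blast
  then show ?case
  proof (rule sums_of_trans)
    fix e assume e: "e \<in> joint_eigenvectors Y"
    then obtain a where a: "\<And>x. x \<in> Y \<Longrightarrow> act x e = scale (a x) e"
      unfolding joint_eigenvectors_def by (auto dest!: bchoice)
    define S where "S = {f \<in> V. \<forall>x\<in>Y. act x f = scale (a x) f}"
    have eS: "e \<in> S"
      using e a by (simp add: S_def joint_eigenvectors_def)
    have "\<And>i. (act u ^^ i) e \<in> V"
    proof -
      fix i show "(act u ^^ i) e \<in> V"
        by (cases i) (use e V_closed in \<open>auto simp: joint_eigenvectors_def\<close>)
    qed
    then obtain p where p: "p \<noteq> 0" "poly_apply (act u) p e = 0"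
      using ex_annihilating_poly[OF fin, of "act u" e] unfolding V_def by blast
    have "e \<in> sums_of {w \<in> S. \<exists>a. act u w = scale a w}"
    proof (rule act.sum_of_eigenvectors[OF _ _ _ _ _ _ p eS])
      show "0 \<in> S"
        unfolding S_def by (simp only: mem_Collect_eq V_closed act.map_zero scale_simps) simp
      show "f + g \<in> S" "f - g \<in> S" if "f \<in> S" "g \<in> S" for f g
        using that unfolding S_def
        by (simp_all add: V_closed act.map_plus act.map_diff scale_distrib
            del: plus_fun_apply minus_apply)
      show "scale c f \<in> S" if "f \<in> S" for c f
        using that unfolding S_def by (simp add: V_closed act.map_scale mult.commute)
      show "act u f \<in> S" if "f \<in> S" for f
        unfolding S_def
      proof (intro CollectI conjI ballI V_closed)
        fix x assume x: "x \<in> Y"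
        then have "act x (act u f) = act u (act x f)"
          using insert.prems(1,2) u by (auto simp flip: act_mult)
        also have "\<dots> = scale (a x) (act u f)"
          using that x by (simp add: S_def act.map_scale)
        finally show "act x (act u f) = scale (a x) (act u f)" .
      qed
      show "w = 0" if "z \<in> S" "w = act u z - scale a z" "act u w = scale a w" for a z w
        using that insert.prems(3)[of u] u
        by (intro act_no_generalised_eigenvectors[of u w z a]) (auto simp: S_def)
    qed
    then show "e \<in> sums_of (joint_eigenvectors (insert u Y))"
      by (rule sums_of_trans) (auto simp: S_def joint_eigenvectors_def intro!: sums_of_base)
  qed
qed

text \<open>A central element is the average of its conjugates, so its action is a combination of the
  finitely many operators given by the following sums.\<close>

definition conj_sum :: "'a \<Rightarrow> 'a \<Rightarrow>\<^sub>0 int" where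
  "conj_sum g = (\<Sum>h\<in>carrier G. frag_of (h \<otimes> g \<otimes> inv h))"

lemma conj_sum_closed: "g \<in> carrier G \<Longrightarrow> conj_sum g \<in> carrier (group_ring G)"
  unfolding conj_sum_def by (intro group_ring_sum_closed) auto

lemma conj_sum_central:
  assumes g: "g \<in> carrier G" and f: "f \<in> carrier (group_ring G)"
  shows "conj_sum g \<otimes>\<^bsub>group_ring G\<^esub> f = f \<otimes>\<^bsub>group_ring G\<^esub> conj_sum g"
  using f
proof (rule group_ring_commute)
  fix x assume x: "x \<in> carrier G"
  have "(\<Sum>h\<in>carrier G. frag_of (h \<otimes> g \<otimes> inv h \<otimes> x)) = (\<Sum>h\<in>carrier G. frag_of (x \<otimes> (h \<otimes> g \<otimes> inv h)))"
  proof (rule sum.reindex_bij_witness[of _ "\<lambda>h. x \<otimes> h" "\<lambda>h. inv x \<otimes> h"])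
    fix h assume h: "h \<in> carrier G"
    have cancel: "x \<otimes> (inv x \<otimes> y) = y" if "y \<in> carrier G" for y
      using x that by (simp flip: m_assoc)
    show "x \<otimes> (inv x \<otimes> h) = h" "inv x \<otimes> (x \<otimes> h) = h"
      using x h by (simp_all flip: m_assoc)
    show "frag_of (x \<otimes> (inv x \<otimes> h \<otimes> g \<otimes> inv (inv x \<otimes> h))) = frag_of (h \<otimes> g \<otimes> inv h \<otimes> x)"
      using x h g by (simp add: inv_mult_group m_assoc cancel)
  qed (use x in auto)
  then show "conj_sum g \<otimes>\<^bsub>group_ring G\<^esub> frag_of x = frag_of x \<otimes>\<^bsub>group_ring G\<^esub> conj_sum g"
    by (simp add: conj_sum_def group_ring_sum)
qed

lemma conjugate_sum:
  assumes "f \<in> carrier (group_ring G)"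
  shows "(\<Sum>h\<in>carrier G. frag_of h \<otimes>\<^bsub>group_ring G\<^esub> f \<otimes>\<^bsub>group_ring G\<^esub> frag_of (inv h))
    = frag_extend conj_sum f"
  using assms
  by (induction rule: group_ring_induct)
    (simp_all add: conj_sum_def frag_extend_diff group_ring_diff sum_subtractf)

lemma card_cmul_central:
  assumes u: "u \<in> central_units G"
  shows "frag_cmul (int (card (carrier G))) u = frag_extend conj_sum u"
proof -
  have "frag_of h \<otimes>\<^bsub>group_ring G\<^esub> u \<otimes>\<^bsub>group_ring G\<^esub> frag_of (inv h) = u" if h: "h \<in> carrier G" for h
  proof -
    have "frag_of h \<otimes>\<^bsub>group_ring G\<^esub> u = u \<otimes>\<^bsub>group_ring G\<^esub> frag_of h"
      using central_unitsD(2)[OF u, of "frag_of h"] h by simp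
    then show ?thesis
      using h central_unitsD(1)[OF u] by (simp add: group_ring_assoc)
  qed
  then have "frag_extend conj_sum u = (\<Sum>h\<in>carrier G. u)"
    using central_unitsD(1)[OF u] by (simp flip: conjugate_sum)
  also have "\<dots> = frag_cmul (int (card (carrier G))) u"
    by (rule poly_mapping_eqI) (simp add: lookup_frag_sum)
  finally show ?thesis ..
qed

text \<open>The multiple \<open>|G| u\<close> is an integer combination of the conjugation sums,
  each acting on \<open>w\<close> by a scalar; division by \<open>|G|\<close> is then carried out on
  the complex side.\<close>

lemma central_unit_eigenvector:
  assumes w: "w \<in> joint_eigenvectors (conj_sum ` carrier G)" and u: "u \<in> central_units G"
  shows "\<exists>a. act u w = scale a w"
proof -
  have "\<exists>a. act (frag_extend conj_sum f) w = scale a w" if "f \<in> carrier (group_ring G)" for f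
    using that
  proof (induction rule: group_ring_induct)
    case zero
    show ?case
      by (intro exI[of _ 0]) (simp only: frag_extend_0 act_zero_left scale_simps)
  next
    case (one x)
    then show ?case
      using w by (auto simp: joint_eigenvectors_def)
  next
    case (diff f g)
    then show ?case
      by (metis frag_extend_diff act_diff_left scale_distrib(4))
  qed
  then obtain a where "scale (of_nat (card (carrier G))) (act u w) = scale a w"
    using card_cmul_central[OF u] central_unitsD(1)[OF u] by (metis act_cmul of_int_of_nat_eq)
  then have "scale (1 / of_nat (card (carrier G))) (scale (of_nat (card (carrier G))) (act u w))
      = scale (1 / of_nat (card (carrier G))) (scale a w)"
    by simp
  moreover have "card (carrier G) \<noteq> 0"
    using fin by auto
  ultimately show ?thesis
    by (auto simp: scale_simps)
qed

text \<open>A unit is recovered from its eigenvalues: applying it to the identity of C[G], written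
  as a sum of joint eigenvectors, returns its coefficients. Bounded logarithms therefore bound
  integer coefficients, leaving finitely many units.\<close>

lemma finite_central_unit_rank:
  obtains k where "\<And>S. int_independent (central_unit_group G) S \<Longrightarrow> card S \<le> k"
proof -
  let ?E = "joint_eigenvectors (conj_sum ` carrier G)"
  let ?\<delta> = "\<lambda>z. if z = \<one> then 1 else (0::complex)"
  have starK: "star (conj_sum g) \<in> carrier (group_ring G)" if "g \<in> carrier G" for g
    using that by (intro star_closed conj_sum_closed)
  have "?\<delta> \<in> sums_of ?E"
    using conj_sum_central conj_sum_closed starK
    by (intro sum_of_joint_eigenvectors) (auto simp: fin V_def)
  then obtain ws where ws: "set ws \<subseteq> ?E - {0}" "?\<delta> = sum_list ws"
    by (rule sums_of_list)
  define I where "I = {..<length ws}"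
  \<comment> \<open>The eigenvalue is unique since \<open>ws ! i\<close> is non-zero; uniqueness
    makes each \<open>\<phi> i\<close> multiplicative on central units.\<close>
  define \<phi> where "\<phi> i u = (SOME a. act u (ws ! i) = scale a (ws ! i))" for i u
  have wsE: "ws ! i \<in> ?E" "ws ! i \<noteq> 0" if "i \<in> I" for i
    using that ws(1) nth_mem[of i ws] unfolding I_def by blast+
  have \<phi>: "act u (ws ! i) = scale (\<phi> i u) (ws ! i)" if "i \<in> I" "u \<in> central_units G" for i u
    unfolding \<phi>_def by (rule someI_ex[OF central_unit_eigenvector]) (use that wsE in auto)
  have unique: "a = b" if "scale a (ws ! i) = scale b (ws ! i)" "i \<in> I" for a b i
    using that wsE(2)[of i] by (auto simp: scale_def fun_eq_iff)
  have \<phi>_mult: "\<phi> i (u \<otimes>\<^bsub>group_ring G\<^esub> v) = \<phi> i u * \<phi> i v"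
    if i: "i \<in> I" and u: "u \<in> central_units G" and v: "v \<in> central_units G" for i u v
  proof (rule unique[OF _ i])
    have "u \<otimes>\<^bsub>group_ring G\<^esub> v \<in> central_units G"
      using comm_group_central_units u v
      by (metis carrier_central_unit_group comm_group_def comm_monoid_def monoid.m_closed
          mult_central_unit_group)
    then have "scale (\<phi> i (u \<otimes>\<^bsub>group_ring G\<^esub> v)) (ws ! i) = act (u \<otimes>\<^bsub>group_ring G\<^esub> v) (ws ! i)"
      using i by (simp add: \<phi>)
    also have "\<dots> = scale (\<phi> i u * \<phi> i v) (ws ! i)"
      using central_unitsD(1) i u v by (simp add: act_mult \<phi> act.map_scale mult.commute)
    finally show "scale (\<phi> i (u \<otimes>\<^bsub>group_ring G\<^esub> v)) (ws ! i) = scale (\<phi> i u * \<phi> i v) (ws ! i)" .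
  qed
  have one: "frag_of \<one> \<in> central_units G"
    by (rule central_unitsI[of _ "frag_of \<one>"]) auto
  have \<phi>_one: "\<phi> i (frag_of \<one>) = 1" if i: "i \<in> I" for i
  proof (rule unique[OF _ i])
    show "scale (\<phi> i (frag_of \<one>)) (ws ! i) = scale 1 (ws ! i)"
      using \<phi>[OF i one] wsE(1)[OF i] by (simp add: act_one joint_eigenvectors_def)
  qed
  have \<phi>_nz: "\<phi> i u \<noteq> 0" if i: "i \<in> I" and u: "u \<in> central_units G" for i u
    using \<phi>_mult[OF i u central_unit_inv(1)[OF u]] central_unit_inv(2)[OF u] \<phi>_one[OF i] by auto
  have coeff: "of_int (Poly_Mapping.lookup u z) = (\<Sum>i\<in>I. \<phi> i u * (ws ! i) z)"
    if u: "u \<in> central_units G" and z: "z \<in> carrier G" for u z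
  proof -
    have "act u ?\<delta> z = (\<Sum>x\<in>carrier G. if x = z then of_int (Poly_Mapping.lookup u x) else 0)"
    proof -
      have "inv x \<otimes> z = \<one> \<longleftrightarrow> x = z" if "x \<in> carrier G" for x
        using that z inv_solve_left[of \<one> x z] by (metis one_closed r_one)
      then show ?thesis
        unfolding act_def using z by (auto intro!: sum.cong)
    qed
    also have "\<dots> = of_int (Poly_Mapping.lookup u z)"
      using fin z by simp
    finally have "of_int (Poly_Mapping.lookup u z) = act u (sum_list ws) z"
      unfolding ws(2) ..
    also have "act u (sum_list ws) = (\<Sum>w\<leftarrow>ws. act u w)"
      by (induction ws) (simp_all only: sum_list.Nil sum_list.Cons list.map act.map_zero act.map_plus)
    also have "\<dots> = (\<Sum>i\<in>I. act u (ws ! i))"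
      by (simp only: sum_list_sum_nth length_map I_def atLeast0LessThan) (auto intro!: sum.cong)
    also have "\<dots> = (\<Sum>i\<in>I. scale (\<phi> i u) (ws ! i))"
      using u by (intro sum.cong) (auto simp: \<phi>)
    also have "\<dots> z = (\<Sum>i\<in>I. \<phi> i u * (ws ! i) z)"
    proof -
      have "(sum f J) z = (\<Sum>i\<in>J. f i z)" for f :: "nat \<Rightarrow> 'a \<Rightarrow> complex" and J
        by (induction J rule: infinite_finite_induct) auto
      then show ?thesis
        by (simp add: scale_apply)
    qed
    finally show ?thesis .
  qed
  define L where "L i u = ln (cmod (\<phi> i u))" for i u
  \<comment> \<open>Logarithms at most 1 mean eigenvalues of modulus at most e, whence the factor
    \<open>exp 1\<close>; summing over \<open>z\<close> gives one bound for all
    coefficients.\<close>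
  define B where "B = \<lceil>\<Sum>z\<in>carrier G. \<Sum>i\<in>I. exp 1 * cmod ((ws ! i) z)\<rceil>"
  have "{u \<in> carrier (central_unit_group G). \<forall>i\<in>I. \<bar>L i u\<bar> \<le> 1}
      \<subseteq> {f. Poly_Mapping.keys f \<subseteq> carrier G \<and> (\<forall>z\<in>carrier G. \<bar>Poly_Mapping.lookup f z\<bar> \<le> B)}"
  proof safe
    fix u assume u: "u \<in> carrier (central_unit_group G)" and Lu: "\<forall>i\<in>I. \<bar>L i u\<bar> \<le> 1"
    then have uC: "u \<in> central_units G"
      by simp
    show "z \<in> carrier G" if "z \<in> Poly_Mapping.keys u" for z
      using central_unitsD(1)[OF uC] that by (auto simp: carrier_group_ring)
    fix z assume z: "z \<in> carrier G"
    have \<phi>_le: "cmod (\<phi> i u) \<le> exp 1" if "i \<in> I" for i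
    proof -
      have "cmod (\<phi> i u) = exp (L i u)"
        using \<phi>_nz[OF that uC] by (simp add: L_def)
      also have "\<dots> \<le> exp 1"
        using Lu that by auto
      finally show ?thesis .
    qed
    have "real_of_int \<bar>Poly_Mapping.lookup u z\<bar> = cmod (of_int (Poly_Mapping.lookup u z))"
      by simp
    also have "\<dots> \<le> (\<Sum>i\<in>I. cmod (\<phi> i u) * cmod ((ws ! i) z))"
      unfolding coeff[OF uC z] by (rule order_trans[OF norm_sum]) (simp add: norm_mult)
    also have "\<dots> \<le> (\<Sum>i\<in>I. exp 1 * cmod ((ws ! i) z))"
      using \<phi>_le by (intro sum_mono mult_right_mono) auto
    also have "\<dots> \<le> (\<Sum>z\<in>carrier G. \<Sum>i\<in>I. exp 1 * cmod ((ws ! i) z))"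
      using fin z
      by (intro member_le_sum[of z "carrier G" "\<lambda>z. \<Sum>i\<in>I. exp 1 * cmod ((ws ! i) z)"])
        (auto intro!: sum_nonneg)
    also have "\<dots> \<le> real_of_int B"
      unfolding B_def by (rule le_of_int_ceiling)
    finally show "\<bar>Poly_Mapping.lookup u z\<bar> \<le> B"
      by simp
  qed
  then have bounded: "finite {u \<in> carrier (central_unit_group G). \<forall>i\<in>I. \<bar>L i u\<bar> \<le> 1}"
    by (rule finite_subset[OF _ finite_bounded_frags[OF fin]])
  have "card S \<le> card I" if "int_independent (central_unit_group G) S" for S
  proof (rule card_independent_le[OF comm_group_central_units _ _ bounded that])
    show "L i (x \<otimes>\<^bsub>central_unit_group G\<^esub> y) = L i x + L i y"
      if "i \<in> I" "x \<in> carrier (central_unit_group G)" "y \<in> carrier (central_unit_group G)" for i x y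
      using that \<phi>_nz by (simp add: L_def \<phi>_mult norm_mult ln_mult)
  qed (simp add: I_def)
  then show ?thesis
    by (rule that)
qed

end

section \<open>Ranks and homomorphisms\<close>

text \<open>Indexing allows images and lifts of an independent set to be treated before they are
  known to be distinct.\<close>

definition int_independent_family :: "('a, 'm) monoid_scheme \<Rightarrow> ('i \<Rightarrow> 'a) \<Rightarrow> 'i set \<Rightarrow> bool" where
  "int_independent_family H f I \<longleftrightarrow> f ` I \<subseteq> carrier H \<and> finite I \<and>
    (\<forall>c :: 'i \<Rightarrow> int. finprod H (\<lambda>i. f i [^]\<^bsub>H\<^esub> c i) I = \<one>\<^bsub>H\<^esub> \<longrightarrow> (\<forall>i\<in>I. c i = 0))"

lemma int_independent_familyI:
  assumes "f ` I \<subseteq> carrier H" "finite I"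
    and "\<And>c :: 'i \<Rightarrow> int. \<And>i. finprod H (\<lambda>i. f i [^]\<^bsub>H\<^esub> c i) I = \<one>\<^bsub>H\<^esub> \<Longrightarrow> i \<in> I \<Longrightarrow> c i = 0"
  shows "int_independent_family H f I"
  using assms unfolding int_independent_family_def by blast

lemma int_independent_familyD:
  assumes "int_independent_family H f I"
  shows "f ` I \<subseteq> carrier H" "finite I"
    and "finprod H (\<lambda>i. f i [^]\<^bsub>H\<^esub> (c i :: int)) I = \<one>\<^bsub>H\<^esub> \<Longrightarrow> i \<in> I \<Longrightarrow> c i = 0"
  using assms unfolding int_independent_family_def by blast+

lemma int_independent_iff_family: "int_independent H S \<longleftrightarrow> int_independent_family H (\<lambda>x. x) S"
  by (simp add: int_independent_def int_independent_family_def)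

context comm_group
begin

text \<open>A repetition \<open>f i = f j\<close> would be the relation with exponent 1 at
  \<open>i\<close> and -1 at \<open>j\<close>.\<close>

lemma int_independent_family_inj:
  assumes f: "int_independent_family G f I"
  shows "inj_on f I"
proof (rule inj_onI, rule ccontr)
  fix i j assume ij: "i \<in> I" "j \<in> I" "f i = f j" "i \<noteq> j"
  note D = int_independent_familyD[OF f]
  let ?c = "\<lambda>i k. if i = k then 1 else (0::int)"
  have car: "f \<in> I \<rightarrow> carrier G"
    using D(1) by auto
  have unit: "finprod G (\<lambda>k. f k [^] ?c i k) I = f i" if "i \<in> I" for i
  proof -
    have "finprod G (\<lambda>k. f k [^] ?c i k) I = (\<Otimes>k\<in>I. if i = k then f k else \<one>)"
      using car D(1) by (intro finprod_cong') (auto simp: image_subset_iff)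
    also have "\<dots> = f i"
      using that D(2) car by (rule finprod_singleton)
    finally show ?thesis .
  qed
  have "finprod G (\<lambda>k. f k [^] (?c i k - ?c j k)) I = \<one>"
    using D(1,2) ij by (intro finprod_int_pow_diff) (simp_all only: unit)
  then have "?c i i - ?c j i = 0"
    using ij(1) by (rule D(3))
  then show False
    using ij(4) by simp
qed

lemma int_independent_family_image:
  assumes f: "int_independent_family G f I"
  shows "int_independent G (f ` I)" "card (f ` I) = card I"
proof -
  note D = int_independent_familyD[OF f]
  note inj = int_independent_family_inj[OF f]
  show "card (f ` I) = card I"
    using inj by (rule card_image)
  have "c x = 0" if eq: "finprod G (\<lambda>x. x [^] (c x :: int)) (f ` I) = \<one>" and x: "x \<in> f ` I" for c x
  proof -
    have "finprod G (\<lambda>i. f i [^] c (f i)) I = \<one>"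
      using eq D(1) by (subst (asm) finprod_reindex[OF _ inj]) auto
    then show ?thesis
      using x D(3)[of "\<lambda>i. c (f i)"] by auto
  qed
  then show "int_independent G (f ` I)"
    unfolding int_independent_def using D by blast
qed

lemma finprod_int_pow:
  assumes "finite I" "f ` I \<subseteq> carrier G"
  shows "finprod G f I [^] (n::int) = finprod G (\<lambda>i. f i [^] n) I"
  using assms
proof (induction I rule: finite_induct)
  case (insert i I)
  then have "f \<in> I \<rightarrow> carrier G" "(\<lambda>i. f i [^] n) \<in> I \<rightarrow> carrier G"
    by auto
  with insert show ?case
    by (simp add: int_pow_distrib finprod_closed)
qed simp

lemma int_torsion_imp_nat_torsion:
  assumes "x \<in> carrier G" "x [^] (c::int) = \<one>" "c \<noteq> 0"
  obtains n :: nat where "n > 0" "x [^] n = \<one>"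
proof (rule that)
  show "nat \<bar>c\<bar> > 0"
    using assms(3) by simp
  have "x [^] \<bar>c\<bar> = \<one>"
    using assms int_pow_neg[of x c] by (cases "c \<ge> 0") auto
  then show "x [^] nat \<bar>c\<bar> = \<one>"
    using int_pow_int[of G x "nat \<bar>c\<bar>"] by simp
qed

end

locale comm_group_hom = H: comm_group H + K: comm_group K + group_hom H K h for H K h
begin

lemma hom_finprod:
  assumes "finite I" "f ` I \<subseteq> carrier H"
  shows "h (finprod H f I) = finprod K (\<lambda>i. h (f i)) I"
  using assms
proof (induction I rule: finite_induct)
  case (insert i I)
  then have "f \<in> I \<rightarrow> carrier H" "(\<lambda>i. h (f i)) \<in> I \<rightarrow> carrier K"
    by auto
  with insert show ?case
    by (simp add: H.finprod_closed)
qed simp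

text \<open>A relation among the images says that the corresponding product in \<open>H\<close> lies
  in the kernel. Some power \<open>n\<close> kills it, so the exponents multiplied by
  \<open>n\<close> form a relation in \<open>S\<close>.\<close>

lemma torsion_kernel_independent:
  assumes tor: "\<And>x. x \<in> carrier H \<Longrightarrow> h x = \<one>\<^bsub>K\<^esub> \<Longrightarrow> \<exists>n>0. x [^]\<^bsub>H\<^esub> (n::nat) = \<one>\<^bsub>H\<^esub>"
    and S: "int_independent H S"
  shows "int_independent_family K h S"
proof (rule int_independent_familyI)
  have S': "S \<subseteq> carrier H" "finite S"
    using S by (auto simp: int_independent_def)
  then show "h ` S \<subseteq> carrier K" "finite S"
    by auto
  fix c :: "_ \<Rightarrow> int" and s
  assume 1: "finprod K (\<lambda>x. h x [^]\<^bsub>K\<^esub> c x) S = \<one>\<^bsub>K\<^esub>" and s: "s \<in> S"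
  define y where "y = finprod H (\<lambda>x. x [^]\<^bsub>H\<^esub> c x) S"
  have car: "(\<lambda>x. x [^]\<^bsub>H\<^esub> c x) ` S \<subseteq> carrier H"
    using S' by auto
  have y: "y \<in> carrier H"
    unfolding y_def using car by (intro H.finprod_closed) auto
  have "h y = finprod K (\<lambda>x. h (x [^]\<^bsub>H\<^esub> c x)) S"
    unfolding y_def using S'(2) car by (rule hom_finprod)
  also have "\<dots> = finprod K (\<lambda>x. h x [^]\<^bsub>K\<^esub> c x) S"
    using S' by (intro K.finprod_cong') (auto simp: hom_int_pow)
  finally have "h y = \<one>\<^bsub>K\<^esub>"
    using 1 by simp
  with y tor obtain n :: nat where n: "n > 0" "y [^]\<^bsub>H\<^esub> n = \<one>\<^bsub>H\<^esub>"
    by blast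
  have "y [^]\<^bsub>H\<^esub> int n = finprod H (\<lambda>x. (x [^]\<^bsub>H\<^esub> c x) [^]\<^bsub>H\<^esub> int n) S"
    unfolding y_def using S'(2) car by (rule H.finprod_int_pow)
  also have "\<dots> = finprod H (\<lambda>x. x [^]\<^bsub>H\<^esub> (c x * int n)) S"
    using S' by (intro H.finprod_cong') (auto simp: H.int_pow_pow)
  finally have "finprod H (\<lambda>x. x [^]\<^bsub>H\<^esub> (c x * int n)) S = \<one>\<^bsub>H\<^esub>"
    using n(2) by (simp add: int_pow_int)
  then have "c s * int n = 0"
    using s int_independent_familyD(3)[OF S[unfolded int_independent_iff_family],
        of "\<lambda>x. c x * int n"] by simp
  then show "c s = 0"
    using n(1) by simp
qed

text \<open>Applying \<open>h\<close> turns the exponents \<open>c s\<close> of the lifts into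
  exponents \<open>k s * c s\<close> of the elements of \<open>S\<close>, and \<open>k s\<close> is
  positive.\<close>

lemma lift_coefficients_eq_0:
  assumes S: "int_independent K S" and k: "\<And>s. s \<in> S \<Longrightarrow> k s > (0::nat)"
    and u: "\<And>s. s \<in> S \<Longrightarrow> u s \<in> carrier H" "\<And>s. s \<in> S \<Longrightarrow> h (u s) = s [^]\<^bsub>K\<^esub> k s"
    and 1: "h (finprod H (\<lambda>s. u s [^]\<^bsub>H\<^esub> (c s :: int)) S) = \<one>\<^bsub>K\<^esub>" and s: "s \<in> S"
  shows "c s = 0"
proof -
  have S': "S \<subseteq> carrier K" "finite S"
    using S by (auto simp: int_independent_def)
  have car: "(\<lambda>s. u s [^]\<^bsub>H\<^esub> c s) ` S \<subseteq> carrier H"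
    using u by auto
  have "\<one>\<^bsub>K\<^esub> = finprod K (\<lambda>s. h (u s [^]\<^bsub>H\<^esub> c s)) S"
    using hom_finprod[OF S'(2) car] 1 by simp
  also have "\<dots> = finprod K (\<lambda>s. s [^]\<^bsub>K\<^esub> (int (k s) * c s)) S"
  proof (rule K.finprod_cong')
    fix s assume s: "s \<in> S"
    then have "h (u s [^]\<^bsub>H\<^esub> c s) = (s [^]\<^bsub>K\<^esub> int (k s)) [^]\<^bsub>K\<^esub> c s"
      using u by (simp add: hom_int_pow int_pow_int)
    also have "\<dots> = s [^]\<^bsub>K\<^esub> (int (k s) * c s)"
      using s S' by (intro K.int_pow_pow) auto
    finally show "h (u s [^]\<^bsub>H\<^esub> c s) = s [^]\<^bsub>K\<^esub> (int (k s) * c s)" .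
  qed (use S' in auto)
  finally have "int (k s) * c s = 0"
    using s int_independent_familyD(3)[OF S[unfolded int_independent_iff_family],
        of "\<lambda>s. int (k s) * c s"] by simp
  then show ?thesis
    using k[OF s] by simp
qed

lemma lift_independent:
  assumes lift: "\<And>y. y \<in> carrier K \<Longrightarrow> \<exists>k>0. \<exists>x\<in>carrier H. h x = y [^]\<^bsub>K\<^esub> (k::nat)"
    and S: "int_independent K S"
  shows "\<exists>S'. int_independent H S' \<and> card S' = card S"
    and "z \<in> carrier H \<Longrightarrow> h z = \<one>\<^bsub>K\<^esub> \<Longrightarrow> (\<And>n::nat. n > 0 \<Longrightarrow> z [^]\<^bsub>H\<^esub> n \<noteq> \<one>\<^bsub>H\<^esub>)
      \<Longrightarrow> \<exists>S'. int_independent H S' \<and> card S' = Suc (card S)"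
proof -
  have S': "S \<subseteq> carrier K" "finite S"
    using S by (auto simp: int_independent_def)
  then have "\<forall>s\<in>S. \<exists>k u. k > 0 \<and> u \<in> carrier H \<and> h u = s [^]\<^bsub>K\<^esub> (k::nat)"
    using lift by blast
  then obtain k u where k: "\<And>s. s \<in> S \<Longrightarrow> k s > (0::nat)"
    and u: "\<And>s. s \<in> S \<Longrightarrow> u s \<in> carrier H" "\<And>s. s \<in> S \<Longrightarrow> h (u s) = s [^]\<^bsub>K\<^esub> k s"
    by (metis (no_types))
  have zero: "c s = 0"
    if "h (finprod H (\<lambda>s. u s [^]\<^bsub>H\<^esub> (c s :: int)) S) = \<one>\<^bsub>K\<^esub>" "s \<in> S" for c s
    using lift_coefficients_eq_0[of S k u c s] S k u that by blast
  have car: "(\<lambda>s. u s [^]\<^bsub>H\<^esub> (c s :: int)) \<in> S \<rightarrow> carrier H" for c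
    using u by auto
  have "int_independent_family H u S"
    using S' u zero by (intro int_independent_familyI) auto
  then show "\<exists>S'. int_independent H S' \<and> card S' = card S"
    using H.int_independent_family_image by blast
  assume z: "z \<in> carrier H" "h z = \<one>\<^bsub>K\<^esub>" "\<And>n::nat. n > 0 \<Longrightarrow> z [^]\<^bsub>H\<^esub> n \<noteq> \<one>\<^bsub>H\<^esub>"
  \<comment> \<open>The index \<open>None\<close> carries the kernel element. Under \<open>h\<close>
    it disappears from any relation, so the lifts have exponent 0 and the remaining power of
    \<open>z\<close> must be trivial.\<close>
  define f where "f = case_option z u"
  have "int_independent_family H f (insert None (Some ` S))"
  proof (rule int_independent_familyI)
    show "f ` insert None (Some ` S) \<subseteq> carrier H" "finite (insert None (Some ` S))"
      using z u S' by (auto simp: f_def)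
    fix c :: "_ \<Rightarrow> int" and i
    assume 1: "finprod H (\<lambda>i. f i [^]\<^bsub>H\<^esub> c i) (insert None (Some ` S)) = \<one>\<^bsub>H\<^esub>"
      and i: "i \<in> insert None (Some ` S)"
    let ?y = "finprod H (\<lambda>s. u s [^]\<^bsub>H\<^esub> c (Some s)) S"
    have y: "?y \<in> carrier H"
      using car by (rule H.finprod_closed)
    have "finprod H (\<lambda>i. f i [^]\<^bsub>H\<^esub> c i) (Some ` S) = ?y"
      using u by (subst H.finprod_reindex) (auto simp: f_def)
    then have zy: "z [^]\<^bsub>H\<^esub> c None \<otimes>\<^bsub>H\<^esub> ?y = \<one>\<^bsub>H\<^esub>"
      using 1 z u S' by (subst (asm) H.finprod_insert) (auto simp: f_def)
    have "h (z [^]\<^bsub>H\<^esub> c None \<otimes>\<^bsub>H\<^esub> ?y) = h ?y"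
      using z y by (simp add: hom_int_pow)
    then have "h ?y = \<one>\<^bsub>K\<^esub>"
      using zy by simp
    then have c0: "c (Some s) = 0" if "s \<in> S" for s
      using zero[of "\<lambda>s. c (Some s)"] that by simp
    then have "?y = \<one>\<^bsub>H\<^esub>"
      by (intro H.finprod_one_eqI) auto
    then have "z [^]\<^bsub>H\<^esub> c None = \<one>\<^bsub>H\<^esub>"
      using zy z by simp
    then have "c None = 0"
      using z H.int_torsion_imp_nat_torsion by blast
    with c0 i show "c i = 0"
      by auto
  qed
  from H.int_independent_family_image[OF this]
  show "\<exists>S'. int_independent H S' \<and> card S' = Suc (card S)"
    using S'(2) by (auto simp: card_image)
qed

end

section \<open>Comparison of the ranks\<close>

lemma central_unit_rank_eq: "central_unit_rank G = torsion_free_rank (central_unit_group G)"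
  by (simp add: central_unit_rank_def central_unit_group_def)

lemma torsion_free_rank_le:
  assumes "\<And>S. int_independent H S \<Longrightarrow> \<exists>S'. int_independent K S' \<and> card S \<le> card S'"
  shows "torsion_free_rank H \<le> torsion_free_rank K"
  unfolding torsion_free_rank_def
proof (rule SUP_mono)
  fix S assume "S \<in> {S. int_independent H S}"
  then obtain S' where "int_independent K S'" "card S \<le> card S'"
    using assms by blast
  then show "\<exists>S'\<in>{S. int_independent K S}. enat (card S) \<le> enat (card S')"
    by auto
qed

text \<open>The bound makes the supremum for \<open>H\<close> a maximum; the set attaining it has a
  larger counterpart in \<open>K\<close>, which gives strictness even if the rank of
  \<open>K\<close> is infinite.\<close>

lemma torsion_free_rank_less:
  assumes bound: "\<And>S. int_independent H S \<Longrightarrow> card S \<le> k"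
    and Suc: "\<And>S. int_independent H S \<Longrightarrow> \<exists>S'. int_independent K S' \<and> card S' = Suc (card S)"
    and ne: "int_independent H T"
  shows "torsion_free_rank H < torsion_free_rank K"
proof -
  have "finite (card ` {S. int_independent H S})"
    by (rule finite_subset[of _ "{..k}"]) (use bound in auto)
  then obtain S where S: "int_independent H S" and max: "\<And>T. int_independent H T \<Longrightarrow> card T \<le> card S"
    using Max_in[of "card ` {S. int_independent H S}"] Max_ge[of "card ` {S. int_independent H S}"] ne
    by (smt (verit) empty_iff image_iff mem_Collect_eq)
  obtain S' where S': "int_independent K S'" "card S' = Suc (card S)"
    using Suc[OF S] by blast
  have "torsion_free_rank H \<le> enat (card S)"
    unfolding torsion_free_rank_def by (rule SUP_least) (use max in auto)
  also have "\<dots> < enat (card S')"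
    by (simp add: S'(2))
  also have "\<dots> \<le> torsion_free_rank K"
    unfolding torsion_free_rank_def by (rule SUP_upper) (use S' in auto)
  finally show ?thesis .
qed

theorem theorem11:
  fixes G :: "('a, 'm) monoid_scheme" and A :: "'a set"
  assumes "group G" and "finite (carrier G)" and "A \<lhd> G"
  shows "central_units G \<inter>
      (\<one>\<^bsub>group_ring G\<^esub> <+\<^bsub>group_ring G\<^esub>
        additive_product (group_ring G) (augmentation_ideal G)
          (augmentation_ideal (G\<lparr>carrier := A\<rparr>)))
      \<subseteq> trivial_central_units G
    \<longleftrightarrow> central_unit_rank G = central_unit_rank (G Mod A)"
proof -
  interpret normal A G
    by fact
  \<comment> \<open>The rank bound is taken on the quotient, whose rank is the one to be
    exceeded.\<close>
  interpret Q: finite_group "G Mod A"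
    using group_Mod assms(2) by (simp add: finite_group_def finite_group_axioms_def carrier_Mod)
  let ?C = "central_unit_group G" and ?D = "central_unit_group (G Mod A)"
  interpret \<pi>: comm_group_hom ?C ?D "coset_proj G A"
    using comm_group_central_units Q.comm_group_central_units coset_proj_group_hom
    by (simp add: comm_group_hom_def group_hom_def)
  have lift: "\<exists>k>0. \<exists>x\<in>carrier ?C. coset_proj G A x = y [^]\<^bsub>?D\<^esub> (k::nat)" if "y \<in> carrier ?D" for y
  proof -
    from that obtain k :: nat and u where "k > 0" "u \<in> central_units G"
      "coset_proj G A u = y [^]\<^bsub>?D\<^esub> k"
      by (auto intro: ex_pow_in_coset_proj_image[OF assms(2)])
    then show ?thesis
      by auto
  qed
  let ?N = "central_units G \<inter> {frag_of \<one>\<^bsub>G\<^esub> + p |p. p \<in> coset_ideal}"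
  have "?N \<subseteq> trivial_central_units G \<longleftrightarrow> central_unit_rank G = central_unit_rank (G Mod A)"
  proof
    assume triv: "?N \<subseteq> trivial_central_units G"
    \<comment> \<open>A power of a kernel element lies in \<open>?N\<close>, so by hypothesis it is
      trivial and hence torsion.\<close>
    have tor: "\<exists>n>0. x [^]\<^bsub>?C\<^esub> (n::nat) = \<one>\<^bsub>?C\<^esub>"
      if x: "x \<in> carrier ?C" and ker: "coset_proj G A x = \<one>\<^bsub>?D\<^esub>" for x
    proof -
      obtain k :: nat and p where k: "k > 0" "p \<in> coset_ideal" "x [^]\<^bsub>?C\<^esub> k = frag_of \<one>\<^bsub>G\<^esub> + p"
        using x ker by (auto intro: kernel_pow_in_coset_ideal[OF assms(2)])
      then have "x [^]\<^bsub>?C\<^esub> k \<in> trivial_central_units G"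
        using triv \<pi>.H.nat_pow_closed[OF x, of k] by auto
      then obtain n :: nat where n: "n > 0" "(x [^]\<^bsub>?C\<^esub> k) [^]\<^bsub>?C\<^esub> n = frag_of \<one>\<^bsub>G\<^esub>"
        using trivial_central_unit_torsion[OF assms(2)] by blast
      then show ?thesis
        using k(1) \<pi>.H.nat_pow_pow[OF x, of k n] by (intro exI[of _ "k * n"]) simp
    qed
    show "central_unit_rank G = central_unit_rank (G Mod A)"
      unfolding central_unit_rank_eq
    proof (rule antisym)
      show "torsion_free_rank ?C \<le> torsion_free_rank ?D"
      proof (rule torsion_free_rank_le)
        fix S assume "int_independent ?C S"
        with tor have "int_independent_family ?D (coset_proj G A) S"
          by (rule \<pi>.torsion_kernel_independent)
        from \<pi>.K.int_independent_family_image[OF this]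
        show "\<exists>S'. int_independent ?D S' \<and> card S \<le> card S'"
          by (metis order_refl)
      qed
      show "torsion_free_rank ?D \<le> torsion_free_rank ?C"
      proof (rule torsion_free_rank_le)
        fix S assume "int_independent ?D S"
        with \<pi>.lift_independent(1)[OF lift]
        show "\<exists>S'. int_independent ?C S' \<and> card S \<le> card S'"
          by (metis order_refl)
      qed
    qed
  next
    assume rank: "central_unit_rank G = central_unit_rank (G Mod A)"
    show "?N \<subseteq> trivial_central_units G"
    proof
      fix u assume u: "u \<in> ?N"
      then have ker: "coset_proj G A u = \<one>\<^bsub>?D\<^esub>"
        using coset_proj_coset_ideal coset_proj_one by auto
      show "u \<in> trivial_central_units G"
      proof (rule ccontr)
        assume "u \<notin> trivial_central_units G"
        \<comment> \<open>Contrapositive of Berman-Higman: a non-trivial central unit has infinite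
          order and can be adjoined to lifts of independent sets.\<close>
        then have nontor: "u [^]\<^bsub>?C\<^esub> n \<noteq> \<one>\<^bsub>?C\<^esub>" if "n > 0" for n :: nat
          using torsion_central_unit_trivial[OF assms(2) _ that] u by auto
        obtain k where bound: "\<And>S. int_independent ?D S \<Longrightarrow> card S \<le> k"
          using Q.finite_central_unit_rank by blast
        have "torsion_free_rank ?D < torsion_free_rank ?C"
        proof (rule torsion_free_rank_less[OF bound, where T = "{}"])
          show "\<exists>S'. int_independent ?C S' \<and> card S' = Suc (card S)" if S: "int_independent ?D S" for S
            using \<pi>.lift_independent(2)[OF lift S _ ker nontor] u by simp
          show "int_independent ?D {}"
            by (simp add: int_independent_def)
        qed
        then show False
          using rank by (simp add: central_unit_rank_eq)
      qed
    qed
  qed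
  then show ?thesis
    by (simp only: one_plus_coset_ideal)
qed

end
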